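(* For $\alpha>0$, $\tau>0$ (with $\tau=T\|H\|^\alpha$) and $\epsilon>0$, let $d^{\mathrm{std}}_\alpha(\tau,\epsilon)$ and $d^{\mathrm{sh}}_\alpha(\tau,\epsilon)$ be the minimal degrees defined in the context for the standard signal $H/\|H\|$ and the shifted signal $2H/\|H\|-I$. Then the following hold. Fixed error: for every fixed $\alpha>0$ and fixed $0<\epsilon<(1-e^{-1})/4$, as $\tau\to\infty$, $$d^{\mathrm{std}}_\alpha(\tau,\epsilon)=\Theta\big(\tau^{1/\alpha}\big),\qquad d^{\mathrm{sh}}_\alpha(\tau,\epsilon)=\Theta\big(\tau^{1/(2\alpha)}\big).$$ Fixed scale: for every fixed $\alpha>0$ and fixed $\tau>0$, as $\epsilon\to0^+$, (i) if $\alpha$ is an even positive integer, $d^{\mathrm{std}}_\alpha(\tau,\epsilon)=\Theta\!\left(\dfrac{\log(1/\epsilon)}{\log\log(1/\epsilon)}\right)$; (ii) if $\alpha$ is an odd positive integer or is noninteger, $d^{\mathrm{std}}_\alpha(\tau,\epsilon)=\Theta\big(\epsilon^{-1/\alpha}\big)$; (iii) if $\alpha$ is a positive integer, $d^{\mathrm{sh}}_\alpha(\tau,\epsilon)=\Theta\!\left(\dfrac{\log(1/\epsilon)}{\log\log(1/\epsilon)}\right)$; (iv) if $\alpha$ is noninteger, $d^{\mathrm{sh}}_\alpha(\tau,\epsilon)=\Theta\big(\epsilon^{-1/(2\alpha)}\big)$. The implied constants may depend on the parameters held fixed in the respective limit.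
   Context: $d^{\mathrm{std}}_\alpha(\tau,\epsilon)$ is the smallest $d$ for which there is a real even polynomial $P$ of degree at most $d$ with $\max_{x\in[-1,1]}|P(x)-e^{-\tau|x|^\alpha}|\le\epsilon$. (This is the class relevant to gap-independent transformations by one ordinary quantum singular value transformation sequence, whose polynomial has definite parity: an odd polynomial vanishes at $0$, where the target equals $1$, so for $\epsilon<1$ it cannot be used.) $d^{\mathrm{sh}}_\alpha(\tau,\epsilon)$ is the smallest $d$ for which there is a real polynomial $Q$ of degree at most $d$ (no parity restriction) with $\max_{s\in[-1,1]}|Q(s)-e^{-\tau[(1+s)/2]^\alpha}|\le\epsilon$. *)

theory Defs
  imports Complex_Main "HOL-Library.Landau_Symbols" "HOL-Computational_Algebra.Polynomial"
begin

text \<open>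
  Throughout, \<open>0 powr \<alpha> = 0\<close>, which is the intended value of the power for \<open>\<alpha> > 0\<close>.
  For \<open>\<epsilon> > 0\<close> the sets of admissible degrees below are nonempty by the Weierstrass
  approximation theorem, so \<open>LEAST\<close> denotes a genuine minimum.
\<close>

definition d_std :: "real \<Rightarrow> real \<Rightarrow> real \<Rightarrow> nat" where
  "d_std \<alpha> \<tau> \<epsilon> = (LEAST d. \<exists>P :: real poly. degree P \<le> d \<and>
     (\<forall>x. poly P (- x) = poly P x) \<and>
     (\<forall>x\<in>{-1..1}. \<bar>poly P x - exp (- \<tau> * \<bar>x\<bar> powr \<alpha>)\<bar> \<le> \<epsilon>))"

definition d_sh :: "real \<Rightarrow> real \<Rightarrow> real \<Rightarrow> nat" where
  "d_sh \<alpha> \<tau> \<epsilon> = (LEAST d. \<exists>Q :: real poly. degree Q \<le> d \<and>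
     (\<forall>s\<in>{-1..1}. \<bar>poly Q s - exp (- \<tau> * ((1 + s) / 2) powr \<alpha>)\<bar> \<le> \<epsilon>))"

end

(*
  Substituting y = x^2 or y = (1 + s) / 2, both degrees are governed by the best approximation of
  exp (- tau y^beta) on [0, 1] by polynomials of degree n, with beta = alpha / 2 or beta = alpha.

  Upper bounds.  The shifted Legendre polynomial q satisfies |q| <= 1 on [0, 1].  Dividing its k-th
  coefficient by k - g gives, after normalisation, a polynomial P with y P' - g P proportional to q;
  by a partial fraction identity it approximates y^g within the product of |j - g| / (j + g) over
  j = 1..n, which is O(n^(-2 g)).  Expanding the exponential settles fixed tau and noninteger beta.
  For fixed error, q also approximates 1 / (1 + A y) with degree of order sqrt A, and exp (- u^beta)
  is a continuous function of 1 / (1 + u).  For integer beta the Taylor polynomial suffices.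

  Lower bounds.  With y = (1 - cos t) / 2, integration against cos (2 n t) times the Fejer kernel
  annihilates the polynomials of degree n, while the Fourier coefficients of y^g have eventually
  constant sign and size k^(-2 g - 1), so nothing cancels.  For fixed error, Bernstein's inequality
  bounds the drop of a bounded polynomial between t = 0 and t of order tau^(-1 / (2 beta)).  For
  integer beta, a high derivative of the error is bounded below near 0, hence so is the error.
*)

theory Submission
  imports Defs "HOL-Analysis.Analysis" "HOL-Real_Asymp.Real_Asymp"
begin

text \<open>The singular point y = 0 is an endpoint of [0, 1]. Under y = (1 - cos t) / 2 it is
  approached like t^2, so y^g behaves like t^(2 g); this doubling explains the exponents 2 g and 1 /
  (2 \<beta>). For noninteger \<beta> the power y^\<beta> alone fixes the rate: in exp (- \<tau>
  y^\<beta>) = 1 - \<tau> y^\<beta> + ... the later terms can be approximated at the faster rate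
  n^(-4 \<beta>), so they cannot hide the error of the first. Infinitely many exponents k \<beta>
  have to be handled by polynomials of one common degree, which is why the error for powers is kept
  as an explicit product: its constants can be followed as k grows, and the weights 1 / k! outweigh
  them. For integer \<beta> there is no singularity; the errors in play have logarithms of order - N
  ln N, so factors of the form c^N do not affect the rate and the estimates may be crude. Lower
  bounds are stated for \<open>real d + 1\<close>, which admits d = 0; as every rate tends to
  infinity, the 1 is absorbed at the end. The upper bounds also supply the admissible degrees that
  make \<open>LEAST\<close> meaningful.\<close>

definition approximable :: "real \<Rightarrow> real \<Rightarrow> real \<Rightarrow> nat \<Rightarrow> bool" where
  "approximable \<beta> \<tau> \<epsilon> d \<longleftrightarrow> (\<exists>P :: real poly. degree P \<le> d \<and>
     (\<forall>y\<in>{0..1}. \<bar>poly P y - exp (- \<tau> * y powr \<beta>)\<bar> \<le> \<epsilon>))"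

section \<open>Shifted Legendre polynomials\<close>

text \<open>These are the coefficients of the classical Legendre polynomial at 1 - 2 y, normalised
  to 1 at y = 0. The differential equation, the value at 1 and the partial fractions below come from
  two recurrences of these coefficients, in \<open>k\<close> and in \<open>n\<close>.\<close>

definition legendre_coeff :: "nat \<Rightarrow> nat \<Rightarrow> real" where
  "legendre_coeff n k = (-1) ^ k * real (n choose k) * real ((n + k) choose k)"

definition legendre :: "nat \<Rightarrow> real poly" where
  "legendre n = (\<Sum>k\<le>n. monom (legendre_coeff n k) k)"

lemma legendre_coeff_0 [simp]: "legendre_coeff n 0 = 1"
  by (simp add: legendre_coeff_def)

lemma legendre_coeff_eq_0 [simp]: "k > n \<Longrightarrow> legendre_coeff n k = 0"
  by (simp add: legendre_coeff_def)

lemma coeff_legendre [simp]: "coeff (legendre n) k = legendre_coeff n k"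
  by (auto simp: legendre_def coeff_sum)

lemma degree_legendre: "degree (legendre n) \<le> n"
  by (rule degree_le) auto

lemma poly_legendre: "poly (legendre n) y = (\<Sum>k\<le>n. legendre_coeff n k * y ^ k)"
  by (simp add: legendre_def poly_sum poly_monom)

lemma legendre_coeff_fact:
  assumes "k \<le> n"
  shows "legendre_coeff n k = (-1) ^ k * fact (n + k) / (fact k ^ 2 * fact (n - k))"
proof -
  have "real (n choose k) = fact n / (fact k * fact (n - k))"
    using assms by (simp add: binomial_fact)
  moreover have "real ((n + k) choose k) = fact (n + k) / (fact k * fact n)"
    by (simp add: binomial_fact)
  ultimately show ?thesis
    by (simp add: legendre_coeff_def power2_eq_square)
qed

text \<open>The term ratio of a hypergeometric sum; compared at \<open>y ^ k\<close> it is the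
  differential equation below. At k = n the factor n - k vanishes, so the coefficients may stop
  there.\<close>

lemma legendre_coeff_Suc_right:
  "(real k + 1)\<^sup>2 * legendre_coeff n (Suc k) = - (real n - real k) * (real n + real k + 1) * legendre_coeff n k"
proof (cases "k < n")
  case True
  then obtain m where m: "n = Suc (k + m)"
    using less_imp_Suc_add by blast
  have f: "fact (Suc (k + m) + Suc k) = (real (k + m + k) + 2) * fact (Suc (k + m) + k)"
    by (simp add: algebra_simps)
  have g: "fact (Suc (k + m) - k) = (real m + 1) * (fact m :: real)"
    by (simp add: Suc_diff_le)
  have h: "fact (Suc k) = (real k + 1) * (fact k :: real)" by simp
  have c1: "legendre_coeff n (Suc k) = - ((-1) ^ k * ((real (k + m + k) + 2) * fact (Suc (k + m) + k)) / (((real k + 1) * fact k) ^ 2 * fact m))"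
    unfolding m by (subst legendre_coeff_fact) (simp, simp only: f h, simp)
  have c0: "legendre_coeff n k = (-1) ^ k * fact (Suc (k + m) + k) / (fact k ^ 2 * ((real m + 1) * fact m))"
    unfolding m by (subst legendre_coeff_fact) (simp, simp only: g)
  have n: "real n - real k = real m + 1" "real n + real k + 1 = real (k + m + k) + 2"
    using m by simp_all
  have alg: "(K + 1)\<^sup>2 * - (s * (R * F) / (((K + 1) * u)\<^sup>2 * v))
      = - (M + 1) * R * (s * F / (u\<^sup>2 * ((M + 1) * v)))"
    if "K + 1 \<noteq> 0" "M + 1 \<noteq> 0" "u \<noteq> 0" "v \<noteq> 0" for K M R F s u v :: real
    using that by (simp add: divide_simps power2_eq_square) (simp add: algebra_simps)
  show ?thesis
    unfolding c1 c0 n by (rule alg) (auto simp: add_nonneg_eq_0_iff)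
next
  case False
  then show ?thesis by (cases "k = n") auto
qed

text \<open>Written without division it stays true at k = n + 1, where both sides are 0. It serves
  the value at 1 and the induction for the partial fractions.\<close>

lemma legendre_coeff_Suc_left:
  "(real n + 1 - real k) * legendre_coeff (Suc n) k = (real n + 1 + real k) * legendre_coeff n k"
proof (cases "k \<le> n")
  case True
  then obtain m where m: "n = k + m" using le_Suc_ex by blast
  have f: "fact (Suc (k + m) + k) = (real (k + m + k) + 1) * fact (k + m + k)"
    by (simp add: algebra_simps)
  have g: "fact (Suc (k + m) - k) = (real m + 1) * (fact m :: real)"
    by (simp add: Suc_diff_le)
  have c1: "legendre_coeff (Suc n) k = (-1) ^ k * ((real (k + m + k) + 1) * fact (k + m + k)) / (fact k ^ 2 * ((real m + 1) * fact m))"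
    unfolding m by (subst legendre_coeff_fact) (simp, simp only: f g)
  have c0: "legendre_coeff n k = (-1) ^ k * fact (k + m + k) / (fact k ^ 2 * fact m)"
    unfolding m by (subst legendre_coeff_fact) simp_all
  have n: "real n + 1 - real k = real m + 1" "real n + 1 + real k = real (k + m + k) + 1"
    using m by simp_all
  have alg: "(M + 1) * (s * (R * F) / (u\<^sup>2 * ((M + 1) * v))) = R * (s * F / (u\<^sup>2 * v))"
    if "M + 1 \<noteq> 0" for M R F s u v :: real
    using that by (simp add: divide_simps)
  show ?thesis
    unfolding c1 c0 n by (rule alg) (auto simp: add_nonneg_eq_0_iff)
next
  case False
  then show ?thesis by (cases "k = Suc n") auto
qed

lemma legendre_ode:
  "y * (1 - y) * poly (pderiv (pderiv (legendre n))) y + (1 - 2 * y) * poly (pderiv (legendre n)) y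
     + real n * (real n + 1) * poly (legendre n) y = 0"
proof -
  let ?q = "legendre n"
  have "[:0, 1, -1:] * pderiv (pderiv ?q) + [:1, -2:] * pderiv ?q + smult (real n * (real n + 1)) ?q = 0"
    (is "?lhs = 0")
  proof (rule poly_eqI)
    fix k
    show "coeff ?lhs k = coeff 0 k"
    proof (cases k)
      case 0
      then show ?thesis
        using legendre_coeff_Suc_right[of 0 n] by (simp add: coeff_pderiv mult_pCons_left algebra_simps)
    next
      case (Suc j)
      then show ?thesis
        using legendre_coeff_Suc_right[of k n]
        by (cases j) (simp_all add: coeff_pderiv mult_pCons_left algebra_simps power2_eq_square)
    qed
  qed
  then have "poly ?lhs y = 0" by simp
  then show ?thesis by (simp add: algebra_simps)
qed

lemma legendre_recurrence:
  "(real n + 1) * poly (legendre (Suc n)) y - y * poly (pderiv (legendre (Suc n))) y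
     = (real n + 1) * poly (legendre n) y + y * poly (pderiv (legendre n)) y"
proof -
  have "smult (real n + 1) (legendre (Suc n)) - pCons 0 (pderiv (legendre (Suc n)))
     = smult (real n + 1) (legendre n) + pCons 0 (pderiv (legendre n))" (is "?l = ?r")
  proof (rule poly_eqI)
    fix k show "coeff ?l k = coeff ?r k"
      using legendre_coeff_Suc_left[of n k] by (cases k) (simp_all add: coeff_pderiv algebra_simps)
  qed
  then have "poly ?l y = poly ?r y" by simp
  then show ?thesis by simp
qed

lemma poly_legendre_0 [simp]: "poly (legendre n) 0 = 1"
  by (simp add: poly_0_coeff_0)

text \<open>At y = 1 the leading coefficient of the differential equation vanishes, so q' is n (n +
  1) q there; inserted in the recurrence in \<open>n\<close>, this flips the sign at each
  step.\<close>

lemma poly_legendre_1: "poly (legendre n) 1 = (-1) ^ n"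
proof (induction n)
  case 0
  show ?case by (simp add: poly_legendre)
next
  case (Suc n)
  have d: "poly (pderiv (legendre k)) 1 = real k * (real k + 1) * poly (legendre k) 1" for k
    using legendre_ode[of 1 k] by simp
  have "(real n + 1)\<^sup>2 * poly (legendre (Suc n)) 1 = - (real n + 1)\<^sup>2 * poly (legendre n) 1"
    using legendre_recurrence[of n 1] unfolding d by (simp add: algebra_simps power2_eq_square)
  then have "(real n + 1)\<^sup>2 * (poly (legendre (Suc n)) 1 + poly (legendre n) 1) = 0"
    by (simp add: distrib_left)
  moreover have "real n + 1 \<noteq> 0" by linarith
  ultimately show ?case using Suc by simp
qed

text \<open>By the differential equation, \<open>q\<^sup>2 + y (1 - y) q'\<^sup>2 / (n (n + 1))\<close> has derivative
  \<open>(2 y - 1) q'\<^sup>2 / (n (n + 1))\<close>, so on \<open>[0, 1]\<close> it is largest at the endpoints, where it equals 1.\<close>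

lemma abs_legendre_le_1:
  assumes "0 \<le> y" "y \<le> 1"
  shows "\<bar>poly (legendre n) y\<bar> \<le> 1"
proof (cases "n = 0")
  case True
  then show ?thesis by (simp add: poly_legendre)
next
  case False
  define N where "N = real n * (real n + 1)"
  have N: "N > 0" using False by (simp add: N_def)
  define q q' q'' where "q = poly (legendre n)" and "q' = poly (pderiv (legendre n))"
    and "q'' = poly (pderiv (pderiv (legendre n)))"
  define f where "f = (\<lambda>y. (q y)\<^sup>2 + y * (1 - y) * (q' y)\<^sup>2 / N)"
  have f': "(f has_real_derivative (2 * x - 1) * (q' x)\<^sup>2 / N) (at x)" for x
  proof -
    have dq: "(q has_real_derivative q' x) (at x)" and dq': "(q' has_real_derivative q'' x) (at x)"
      by (auto simp: q_def q'_def q''_def)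
    have e: "x * (1 - x) * q'' x = - (1 - 2 * x) * q' x - N * q x"
      using legendre_ode[of x n] by (simp add: q_def q'_def q''_def N_def algebra_simps)
    have "(f has_real_derivative 2 * q x * q' x + ((1 - 2 * x) * (q' x)\<^sup>2 + x * (1 - x) * (2 * q' x * q'' x)) / N) (at x)"
      unfolding f_def using N by (auto intro!: derivative_eq_intros dq dq' simp: field_simps power2_eq_square)
    moreover have "x * (1 - x) * (2 * q' x * q'' x) = 2 * q' x * (- (1 - 2 * x) * q' x - N * q x)"
      using e by (metis (no_types, opaque_lifting) mult.assoc mult.left_commute)
    moreover have "2 * q x * q' x + ((1 - 2 * x) * (q' x)\<^sup>2 + 2 * q' x * (- (1 - 2 * x) * q' x - N * q x)) / N
        = (2 * x - 1) * (q' x)\<^sup>2 / N"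
      using N by (simp add: field_simps power2_eq_square)
    ultimately show ?thesis by simp
  qed
  have "f y \<le> 1"
  proof (cases "y \<le> 1/2")
    case True
    have "f y \<le> f 0"
    proof (rule DERIV_nonpos_imp_nonincreasing[OF assms(1)])
      fix x assume "0 \<le> x" "x \<le> y"
      then show "\<exists>d. (f has_real_derivative d) (at x) \<and> d \<le> 0"
        using f'[of x] True N by (intro exI conjI) (auto intro!: divide_nonpos_pos mult_nonpos_nonneg)
    qed
    then show ?thesis by (simp add: f_def q_def)
  next
    case False
    have "f y \<le> f 1"
    proof (rule DERIV_nonneg_imp_nondecreasing[OF assms(2)])
      fix x assume "y \<le> x" "x \<le> 1"
      then show "\<exists>d. (f has_real_derivative d) (at x) \<and> d \<ge> 0"
        using f'[of x] False N by (intro exI conjI) (auto intro!: divide_nonneg_pos mult_nonneg_nonneg)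
    qed
    also have "f 1 = 1" by (simp add: f_def q_def poly_legendre_1 flip: power_mult)
    finally show ?thesis .
  qed
  moreover have "(q y)\<^sup>2 \<le> f y" using assms N by (simp add: f_def)
  ultimately have "(q y)\<^sup>2 \<le> 1" by linarith
  then show ?thesis by (simp add: q_def abs_square_le_1)
qed

text \<open>Splitting \<open>n + 1 - g = (n + 1 - k) + (k - g)\<close> and \<open>n + 1 + g = (n + 1 + k) - (k - g)\<close> shows that the
  difference of the two sides in the induction step is \<open>poly (legendre (Suc n)) 1 + poly (legendre n) 1 = 0\<close>.\<close>

lemma legendre_partial_fractions:
  assumes "\<forall>j\<le>n. g \<noteq> real j"
  shows "(\<Sum>k\<le>n. legendre_coeff n k / (real k - g)) = - (1 / g) * (\<Prod>j=1..n. (real j + g) / (real j - g))"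
  using assms
proof (induction n)
  case 0
  then show ?case by simp
next
  case (Suc n)
  define S where "S = (\<lambda>m. \<Sum>k\<le>m. legendre_coeff m k / (real k - g))"
  have ne: "real k - g \<noteq> 0" if "k \<le> Suc n" for k using Suc.prems that by auto
  \<comment> \<open>The added term k = n + 1 is 0; both sums now run over the same range.\<close>
  have Sn: "S n = (\<Sum>k\<le>Suc n. legendre_coeff n k / (real k - g))" by (simp add: S_def)
  have step: "(real n + 1 - g) * (legendre_coeff (Suc n) k / (real k - g))
      - (real n + 1 + g) * (legendre_coeff n k / (real k - g)) = legendre_coeff (Suc n) k + legendre_coeff n k"
    if "k \<le> Suc n" for k
  proof -
    have "(real n + 1 - g) * legendre_coeff (Suc n) k - (real n + 1 + g) * legendre_coeff n k
      = (real k - g) * (legendre_coeff (Suc n) k + legendre_coeff n k)"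
      using legendre_coeff_Suc_left[of n k] by (simp add: algebra_simps)
    then show ?thesis using ne[OF that] by (simp add: divide_simps)
  qed
  have "(real n + 1 - g) * S (Suc n) - (real n + 1 + g) * S n
      = (\<Sum>k\<le>Suc n. legendre_coeff (Suc n) k + legendre_coeff n k)"
    unfolding Sn unfolding S_def sum_distrib_left sum_subtractf[symmetric]
    by (intro sum.cong refl step) auto
  also have "\<dots> = poly (legendre (Suc n)) 1 + poly (legendre n) 1"
    by (simp add: poly_legendre sum.distrib)
  also have "\<dots> = 0" by (simp add: poly_legendre_1)
  finally have "S (Suc n) = (real n + 1 + g) / (real n + 1 - g) * S n"
    using ne[of "Suc n"] by (simp add: divide_simps) (simp add: algebra_simps)
  moreover have "S n = - (1 / g) * (\<Prod>j=1..n. (real j + g) / (real j - g))"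
    using Suc unfolding S_def by auto
  ultimately have "S (Suc n) = - (1 / g) * ((\<Prod>j=1..n. (real j + g) / (real j - g)) * ((real n + 1 + g) / (real n + 1 - g)))"
    by (simp only: mult_ac)
  also have "(\<Prod>j=1..n. (real j + g) / (real j - g)) * ((real n + 1 + g) / (real n + 1 - g)) = (\<Prod>j=1..Suc n. (real j + g) / (real j - g))"
    by (simp add: add.commute)
  finally show ?case unfolding S_def .
qed

section \<open>Upper bounds for powers\<close>

text \<open>With \<open>P = (\<Sum>k. c k / (k - g) y ^ k) / S\<close>, where \<open>S\<close> normalises \<open>P 1 = 1\<close>, one has
  \<open>y P' - g P = q / S\<close> for the Legendre polynomial \<open>q\<close>; hence
  \<open>y powr (-g) * P y\<close> varies by at most \<open>(y powr (-g) - 1) / (g \<bar>S\<bar>)\<close> on \<open>[y, 1]\<close>.\<close>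

lemma powr_polynomial_approx:
  assumes g: "g > 0"
  shows "\<exists>P :: real poly. degree P \<le> n \<and>
    (\<forall>y\<in>{0..1}. \<bar>poly P y - y powr g\<bar> \<le> (\<Prod>j=1..n. \<bar>real j - g\<bar> / (real j + g)))"
proof (cases "\<exists>j\<le>n. g = real j")
  \<comment> \<open>An integer exponent up to \<open>n\<close> would be a pole of the sum
    \<open>S\<close>; here the monomial itself is exact.\<close>
  case True
  then obtain j where j: "j \<le> n" "g = real j" by blast
  have "poly (monom 1 j) y - y powr g = 0" if "y \<in> {0..1}" for y
    using that g j by (cases "y = 0") (auto simp: poly_monom powr_realpow)
  then show ?thesis
    using j g by (intro exI[of _ "monom 1 j"] conjI ballI) (auto simp: degree_monom_eq intro!: prod_nonneg)
next
  case False
  define S where "S = (\<Sum>k\<le>n. legendre_coeff n k / (real k - g))"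
  have S: "S = - (1 / g) * (\<Prod>j=1..n. (real j + g) / (real j - g))"
    unfolding S_def by (rule legendre_partial_fractions) (use False in auto)
  have S0: "S \<noteq> 0" unfolding S using g False by (auto simp: divide_simps)
  \<comment> \<open>\<open>E\<close> is the error at y = 0, because \<open>poly P 0\<close> is - 1 /
    (g S). The rest of the proof shows that no other point is worse.\<close>
  define E where "E = 1 / (g * \<bar>S\<bar>)"
  have E: "E = (\<Prod>j=1..n. \<bar>real j - g\<bar> / (real j + g))"
  proof -
    have "g * \<bar>S\<bar> = (\<Prod>j=1..n. \<bar>(real j + g) / (real j - g)\<bar>)"
      unfolding S using g by (simp add: abs_mult abs_prod)
    also have "1 / \<dots> = (\<Prod>j=1..n. 1 / \<bar>(real j + g) / (real j - g)\<bar>)"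
      by (subst prod_dividef) simp
    also have "\<dots> = (\<Prod>j=1..n. \<bar>real j - g\<bar> / (real j + g))"
      using g by (intro prod.cong) (auto simp: abs_divide)
    finally show ?thesis unfolding E_def .
  qed
  have E0: "E > 0" using g S0 by (simp add: E_def)
  define P where "P = (\<Sum>k\<le>n. monom (legendre_coeff n k / (real k - g) / S) k)"
  have coeffP: "coeff P k = legendre_coeff n k / (real k - g) / S" for k
    by (auto simp: P_def coeff_sum)
  have ode: "y * poly (pderiv P) y - g * poly P y = poly (legendre n) y / S" for y
  proof -
    have "pCons 0 (pderiv P) - smult g P = smult (1 / S) (legendre n)"
    proof (rule poly_eqI)
      fix k
      have "real k * coeff P k - g * coeff P k = legendre_coeff n k / S"
      proof (cases "k \<le> n")
        case True
        then have "real k - g \<noteq> 0" using False by auto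
        then show ?thesis by (simp add: coeffP divide_simps flip: left_diff_distrib)
      qed (simp add: coeffP)
      then show "coeff (pCons 0 (pderiv P) - smult g P) k = coeff (smult (1 / S) (legendre n)) k"
        by (cases k) (simp_all add: coeff_pderiv)
    qed
    then have "poly (pCons 0 (pderiv P) - smult g P) y = poly (smult (1 / S) (legendre n)) y" by simp
    then show ?thesis by simp
  qed
  have P1: "poly P 1 = 1"
    using S0 by (simp add: P_def poly_sum poly_monom flip: sum_divide_distrib S_def del: divide_divide_eq_left)
  have P0: "poly P 0 = - (1 / (g * S))"
    by (simp add: poly_0_coeff_0 coeffP)
  have bound: "s * (poly P y - y powr g) \<le> E" if s: "\<bar>s\<bar> = 1" and y: "0 < y" "y \<le> 1" for s y
  proof -
    \<comment> \<open>The shift by \<open>E\<close> makes \<open>F\<close> increase: its derivative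
      is y^(-g-1) (s q / S + g E), where g E = 1 / |S| outweighs q / S. The sign \<open>s\<close>
      yields both one-sided estimates.\<close>
    define F where "F = (\<lambda>y. y powr (- g) * (s * poly P y - E))"
    have "F y \<le> F 1"
    proof (rule DERIV_nonneg_imp_nondecreasing[OF y(2)])
      fix x assume x: "y \<le> x" "x \<le> 1"
      with y have x0: "x > 0" by simp
      let ?d = "x powr (- g - 1) * (s * poly (legendre n) x / S + g * E)"
      have "(F has_real_derivative (- g * x powr (- g - 1)) * (s * poly P x - E) + x powr (- g) * (s * poly (pderiv P) x)) (at x)"
        unfolding F_def using x0 by (auto intro!: derivative_eq_intros)
      moreover have "x powr (- g) = x powr (- g - 1) * x"
        using x0 by (simp add: powr_diff)
      moreover have "(- g * x powr (- g - 1)) * (s * poly P x - E) + x powr (- g - 1) * x * (s * poly (pderiv P) x)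
          = x powr (- g - 1) * (s * (x * poly (pderiv P) x - g * poly P x) + g * E)"
        by (simp add: algebra_simps)
      ultimately have "(F has_real_derivative ?d) (at x)"
        by (simp add: ode)
      moreover have "?d \<ge> 0"
      proof -
        have "- (s * poly (legendre n) x / S) \<le> \<bar>s * poly (legendre n) x / S\<bar>" by (rule abs_ge_minus_self)
        also have "\<dots> \<le> 1 / \<bar>S\<bar>"
          using abs_legendre_le_1[of x n] x x0 s by (simp add: abs_mult divide_right_mono)
        also have "1 / \<bar>S\<bar> = g * E" using g by (simp add: E_def)
        finally show ?thesis by (intro mult_nonneg_nonneg) auto
      qed
      ultimately show "\<exists>d. (F has_real_derivative d) (at x) \<and> 0 \<le> d" by blast
    qed
    then have "y powr (- g) * (s * poly P y - E) \<le> s - E" by (simp add: F_def P1)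
    then have "y powr g * (y powr (- g) * (s * poly P y - E)) \<le> y powr g * (s - E)"
      by (intro mult_left_mono) auto
    moreover have "y powr g * (y powr (- g) * z) = z" for z
      using y by (simp add: powr_minus)
    ultimately have "s * poly P y - E \<le> y powr g * (s - E)" by simp
    moreover have "y powr g * E \<ge> 0" using E0 by simp
    ultimately show ?thesis by (simp add: algebra_simps)
  qed
  have "\<bar>poly P y - y powr g\<bar> \<le> E" if "y \<in> {0..1}" for y
  proof (cases "y = 0")
    case True
    then show ?thesis using g by (simp add: P0 E_def abs_mult)
  next
    case False
    then show ?thesis using bound[of 1 y] bound[of "-1" y] that by auto
  qed
  moreover have "degree P \<le> n" by (rule degree_le) (simp add: coeffP)
  ultimately show ?thesis unfolding E by blast
qed

text \<open>A factor with j > g is at most exp (- 2 g / (j + g)), hence at most ((j + g) / (j + g +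
  1)) powr p, and these telescope. The exponent \<open>p\<close> is free below 2 g so that one rate
  can serve all powers of an exponential tail.\<close>

lemma powr_approx_error_le:
  assumes g: "g > 0" and p: "0 \<le> p" "p \<le> 2 * g"
  shows "(\<Prod>j=1..n. \<bar>real j - g\<bar> / (real j + g)) \<le> ((2 * g + 1) / (real n + g + 1)) powr p"
proof (induction n)
  case 0
  have "1 = 1 powr p" by simp
  also have "\<dots> \<le> ((2 * g + 1) / (g + 1)) powr p"
    using g p by (intro powr_mono2) auto
  finally show ?case by simp
next
  case (Suc n)
  show ?case
  proof (cases "real (Suc n) \<le> g")
    \<comment> \<open>As long as the index is at most \<open>g\<close> there is no decay to use,
      only the bound 1; the numerator 2 g + 1 is chosen so that the base is still at least 1
      here.\<close>
    case True
    have "(\<Prod>j=1..Suc n. \<bar>real j - g\<bar> / (real j + g)) \<le> 1"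
      using g by (intro prod_le_1) auto
    also have "1 = 1 powr p" by simp
    also have "\<dots> \<le> ((2 * g + 1) / (real (Suc n) + g + 1)) powr p"
      using g p True by (intro powr_mono2) auto
    finally show ?thesis .
  next
    case False
    define j where "j = real (Suc n)"
    have j: "j > g" using False by (simp add: j_def)
    have "(j - g) / (j + g) = 1 + (- 2 * g / (j + g))" using g j by (simp add: field_simps)
    also have "\<dots> \<le> exp (- 2 * g / (j + g))" by (rule exp_ge_add_one_self)
    also have "\<dots> \<le> exp (- (p / (j + g)))"
      using g j p by (auto intro!: divide_right_mono)
    also have "\<dots> \<le> exp (- (p * ln (1 + 1 / (j + g))))"
      using g j p mult_left_mono[OF ln_add_one_self_le_self[of "1 / (j + g)"], of p] by simp
    also have "\<dots> = (1 + 1 / (j + g)) powr (- p)"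
      using add_pos_pos[of 1 "1 / (j + g)"] g j by (simp add: powr_def)
    also have "\<dots> = ((j + g) / (j + g + 1)) powr p"
      using g j by (simp add: powr_minus powr_divide field_simps inverse_eq_divide add_divide_distrib[symmetric])
    finally have *: "(j - g) / (j + g) \<le> ((j + g) / (j + g + 1)) powr p" .
    have "(\<Prod>j=1..Suc n. \<bar>real j - g\<bar> / (real j + g))
        = (\<Prod>j=1..n. \<bar>real j - g\<bar> / (real j + g)) * ((j - g) / (j + g))"
      using j by (simp add: j_def)
    also have "\<dots> \<le> ((2 * g + 1) / (real n + g + 1)) powr p * ((j + g) / (j + g + 1)) powr p"
      using Suc * g j by (intro mult_mono) auto
    also have "\<dots> = ((2 * g + 1) / (real n + g + 1) * ((j + g) / (j + g + 1))) powr p"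
      by (rule powr_mult[symmetric])
    also have "(2 * g + 1) / (real n + g + 1) * ((j + g) / (j + g + 1)) = (2 * g + 1) / (real (Suc n) + g + 1)"
      using g by (simp add: j_def divide_simps)
    finally show ?thesis .
  qed
qed

text \<open>Once the terms below \<open>k0\<close> are removed, every remaining power y^(k \<beta>)
  has rate at least n^(-2 k0 \<beta>). The case k0 = 1 gives the upper bound for noninteger
  exponents, the case k0 = 2 the remainder in the lower bound.\<close>

lemma exp_powr_tail_approx:
  fixes \<beta> t :: real
  assumes b: "\<beta> > 0" and k0: "k0 > 0"
  obtains C where "C > 0" and "\<And>n. \<exists>P :: real poly. degree P \<le> n \<and> (\<forall>y\<in>{0..1}.
      \<bar>poly P y - (exp (t * y powr \<beta>) - (\<Sum>k<k0. (t * y powr \<beta>) ^ k / fact k))\<bar>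
        \<le> C * (real n + 1) powr (- (2 * real k0 * \<beta>)))"
proof -
  define p where "p = 2 * real k0 * \<beta>"
  have p: "p > 0" using assms by (simp add: p_def)
  define a where "a = (\<lambda>k. \<bar>t\<bar> ^ k / fact k * (2 * real k * \<beta> + 1) powr p)"
  obtain q :: nat where q: "p \<le> real q" using real_arch_simple by blast
  have "summable a"
  proof (rule summable_comparison_test')
    let ?c = "\<bar>t\<bar> * exp (2 * \<beta> * p)"
    show "summable (\<lambda>k. exp p * (?c ^ k / fact k))"
      using summable_exp[of ?c] by (intro summable_mult) (simp add: divide_inverse mult.commute)
    fix k :: nat assume "k \<ge> 0"
    have "(2 * real k * \<beta> + 1) powr p \<le> exp (2 * real k * \<beta> + 1) powr p"
      using b p by (intro powr_mono2) (auto intro: order_trans[OF _ exp_ge_add_one_self])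
    also have "\<dots> = exp p * exp (2 * \<beta> * p) ^ k"
      by (simp add: powr_def algebra_simps flip: exp_of_nat_mult exp_add)
    finally have "\<bar>t\<bar> ^ k / fact k * (2 * real k * \<beta> + 1) powr p \<le> \<bar>t\<bar> ^ k / fact k * (exp p * exp (2 * \<beta> * p) ^ k)"
      by (intro mult_left_mono) auto
    then show "norm (a k) \<le> exp p * (?c ^ k / fact k)"
      by (simp add: a_def power_mult_distrib mult_ac)
  qed
  \<comment> \<open>The sum pays for the approximated powers, the 1 for cutting off the exponential
    series.\<close>
  define C where "C = suminf a + 1"
  have a0: "a k \<ge> 0" for k by (simp add: a_def)
  have C: "C > 0" using suminf_nonneg[OF \<open>summable a\<close>] a0 by (simp add: C_def add_nonneg_pos)
  have "\<exists>P :: real poly. degree P \<le> n \<and> (\<forall>y\<in>{0..1}.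
      \<bar>poly P y - (exp (t * y powr \<beta>) - (\<Sum>k<k0. (t * y powr \<beta>) ^ k / fact k))\<bar> \<le> C * (real n + 1) powr (- p))" for n
  proof -
    have "\<exists>P :: real poly. degree P \<le> n \<and> (\<forall>y\<in>{0..1}. \<bar>poly P y - y powr (real k * \<beta>)\<bar>
        \<le> (2 * real k * \<beta> + 1) powr p * (real n + 1) powr (- p))" if k: "k \<ge> k0" for k
    proof -
      have g: "real k * \<beta> > 0" using b k k0 by simp
      have pk: "p \<le> 2 * (real k * \<beta>)" using k b by (simp add: p_def)
      have "(\<Prod>j=1..n. \<bar>real j - real k * \<beta>\<bar> / (real j + real k * \<beta>))
          \<le> ((2 * (real k * \<beta>) + 1) / (real n + real k * \<beta> + 1)) powr p"
        using p by (intro powr_approx_error_le g pk) auto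
      also have "\<dots> \<le> ((2 * (real k * \<beta>) + 1) / (real n + 1)) powr p"
        using g p by (intro powr_mono2 divide_left_mono) auto
      also have "\<dots> = (2 * real k * \<beta> + 1) powr p * (real n + 1) powr (- p)"
        using g by (simp add: powr_divide powr_minus_divide mult_ac)
      finally show ?thesis
        using powr_polynomial_approx[OF g, of n] by (meson order_trans)
    qed
    then obtain P :: "nat \<Rightarrow> real poly" where P: "\<And>k. k \<ge> k0 \<Longrightarrow> degree (P k) \<le> n"
      "\<And>k y. k \<ge> k0 \<Longrightarrow> y \<in> {0..1} \<Longrightarrow> \<bar>poly (P k) y - y powr (real k * \<beta>)\<bar>
        \<le> (2 * real k * \<beta> + 1) powr p * (real n + 1) powr (- p)" by metis
    define \<eta> where "\<eta> = (real n + 1) powr (- p)"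
    have eta: "\<eta> > 0" by (simp add: \<eta>_def)
    have expo: "(\<lambda>k. z ^ k / fact k) sums exp z" for z :: real
      using exp_converges[of z] by (simp add: divide_inverse mult.commute)
    have "(\<lambda>K. \<Sum>k<K. \<bar>t\<bar> ^ k / fact k) \<longlonglongrightarrow> exp \<bar>t\<bar>"
      using expo[of "\<bar>t\<bar>"] by (simp add: sums_def)
    \<comment> \<open>The cut-off \<open>K\<close> may depend on \<open>n\<close>: all
      \<open>P k\<close> have degree at most \<open>n\<close>, so the number of terms does not enter
      the degree.\<close>
    then have "\<forall>\<^sub>F K in sequentially. (\<Sum>k<K. \<bar>t\<bar> ^ k / fact k) > exp \<bar>t\<bar> - \<eta>"
      using eta by (intro order_tendstoD) auto
    then have "\<forall>\<^sub>F K in sequentially. K \<ge> k0 \<and> (\<Sum>k<K. \<bar>t\<bar> ^ k / fact k) > exp \<bar>t\<bar> - \<eta>"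
      by (intro eventually_conj eventually_ge_at_top)
    then obtain K where K: "K \<ge> k0" "(\<Sum>k<K. \<bar>t\<bar> ^ k / fact k) > exp \<bar>t\<bar> - \<eta>"
      using eventually_happens' sequentially_bot by blast
    have tail: "\<bar>exp z - (\<Sum>k<K. z ^ k / fact k)\<bar> \<le> \<eta>" if z: "\<bar>z\<bar> \<le> \<bar>t\<bar>" for z
    proof -
      have s: "(\<lambda>k. z ^ (k + K) / fact (k + K)) sums (exp z - (\<Sum>k<K. z ^ k / fact k))"
        using expo[of z] by (rule sums_split_initial_segment)
      have s': "(\<lambda>k. \<bar>t\<bar> ^ (k + K) / fact (k + K)) sums (exp \<bar>t\<bar> - (\<Sum>k<K. \<bar>t\<bar> ^ k / fact k))"
        using expo[of "\<bar>t\<bar>"] by (rule sums_split_initial_segment)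
      have "norm (exp z - (\<Sum>k<K. z ^ k / fact k)) \<le> exp \<bar>t\<bar> - (\<Sum>k<K. \<bar>t\<bar> ^ k / fact k)"
        unfolding sums_unique[OF s] sums_unique[OF s']
        using z by (intro norm_suminf_le sums_summable[OF s'])
           (auto simp: power_abs abs_mult intro!: divide_right_mono power_mono)
      then show ?thesis using K by simp
    qed
    define Q where "Q = (\<Sum>k=k0..<K. smult (t ^ k / fact k) (P k))"
    have "degree Q \<le> n" unfolding Q_def
      by (intro degree_sum_le) (auto intro!: order_trans[OF degree_smult_le P(1)] simp del: degree_smult_eq)
    moreover have "\<bar>poly Q y - (exp (t * y powr \<beta>) - (\<Sum>k<k0. (t * y powr \<beta>) ^ k / fact k))\<bar> \<le> C * \<eta>"
      if y: "y \<in> {0..1}" for y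
    proof -
      let ?z = "t * y powr \<beta>"
      have z: "\<bar>?z\<bar> \<le> \<bar>t\<bar>"
        using y b powr_mono2[of \<beta> y 1] by (auto simp: abs_mult intro!: mult_left_le)
      have pw: "?z ^ k / fact k = t ^ k / fact k * y powr (real k * \<beta>)" if "k \<ge> k0" for k
        using y b k0 that by (cases "y = 0") (auto simp: power_mult_distrib powr_powr mult.commute simp flip: powr_realpow)
      have "(\<Sum>k<K. ?z ^ k / fact k) = (\<Sum>k<k0. ?z ^ k / fact k) + (\<Sum>k=k0..<K. ?z ^ k / fact k)"
        using K(1) by (metis lessThan_atLeast0 sum.atLeastLessThan_concat zero_le)
      then have "poly Q y - (exp ?z - (\<Sum>k<k0. ?z ^ k / fact k))
         = (\<Sum>k=k0..<K. t ^ k / fact k * (poly (P k) y - y powr (real k * \<beta>))) - (exp ?z - (\<Sum>k<K. ?z ^ k / fact k))"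
        by (simp add: Q_def poly_sum pw right_diff_distrib sum_subtractf)
      moreover have "\<bar>\<Sum>k=k0..<K. t ^ k / fact k * (poly (P k) y - y powr (real k * \<beta>))\<bar> \<le> (\<Sum>k=k0..<K. a k * \<eta>)"
      proof (intro order_trans[OF sum_abs] sum_mono)
        fix k assume "k \<in> {k0..<K}"
        then have "\<bar>t\<bar> ^ k / fact k * \<bar>poly (P k) y - y powr (real k * \<beta>)\<bar>
            \<le> \<bar>t\<bar> ^ k / fact k * ((2 * real k * \<beta> + 1) powr p * (real n + 1) powr (- p))"
          using P(2)[of k y] y by (intro mult_left_mono) auto
        then show "\<bar>t ^ k / fact k * (poly (P k) y - y powr (real k * \<beta>))\<bar> \<le> a k * \<eta>"
          by (simp add: a_def \<eta>_def abs_mult power_abs mult_ac)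
      qed
      moreover have "(\<Sum>k=k0..<K. a k * \<eta>) \<le> suminf a * \<eta>"
        unfolding sum_distrib_right[symmetric] using eta a0
        by (intro mult_right_mono sum_le_suminf \<open>summable a\<close>) auto
      ultimately show ?thesis using tail[OF z] by (simp add: C_def algebra_simps)
    qed
    ultimately show ?thesis unfolding \<eta>_def by blast
  qed
  then show ?thesis using that[OF C] unfolding p_def by blast
qed

section \<open>The Fejer kernel and Bernstein's inequality\<close>

text \<open>The squared modulus of the sum of exp (i j t) over j < n, that is, n times the usual
  Fejer kernel. In this form it is visibly nonnegative, and \<open>fejer_eq\<close> shows its
  frequencies i - j, all below n in modulus.\<close>

definition fejer :: "nat \<Rightarrow> real \<Rightarrow> real" where
  "fejer n t = (\<Sum>j<n. cos (real j * t))\<^sup>2 + (\<Sum>j<n. sin (real j * t))\<^sup>2"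

lemma fejer_nonneg: "fejer n t \<ge> 0"
  by (simp add: fejer_def)

lemma fejer_minus [simp]: "fejer n (- t) = fejer n t"
  by (simp add: fejer_def sum_negf)

lemma fejer_eq: "fejer n t = (\<Sum>i<n. \<Sum>j<n. cos ((real i - real j) * t))"
  by (simp add: fejer_def power2_eq_square sum_product cos_diff left_diff_distrib sum.distrib)

lemma continuous_on_fejer [continuous_intros]: "continuous_on A (fejer n)"
  unfolding fejer_def by (intro continuous_intros)

text \<open>The span of the cosines up to frequency \<open>n\<close>. As an inductive predicate it
  reduces the two linear integral identities below to single cosines by rule induction.\<close>

inductive cos_poly :: "nat \<Rightarrow> (real \<Rightarrow> real) \<Rightarrow> bool" for n where
  cos: "k \<le> n \<Longrightarrow> cos_poly n (\<lambda>t. cos (real k * t))"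
| add: "cos_poly n f \<Longrightarrow> cos_poly n g \<Longrightarrow> cos_poly n (\<lambda>t. f t + g t)"
| scale: "cos_poly n f \<Longrightarrow> cos_poly n (\<lambda>t. c * f t)"

lemma cos_poly_Suc: "cos_poly n f \<Longrightarrow> cos_poly (Suc n) f"
  by (induction rule: cos_poly.induct) (auto intro: cos_poly.intros)

lemma cos_poly_mult_cos: "cos_poly n f \<Longrightarrow> cos_poly (Suc n) (\<lambda>t. cos t * f t)"
proof (induction rule: cos_poly.induct)
  case (cos k)
  show ?case
  proof (cases k)
    case 0
    then show ?thesis using cos_poly.cos[of 1 "Suc n"] by simp
  next
    case (Suc j)
    have "(\<lambda>t. cos t * cos (real k * t)) = (\<lambda>t. 1/2 * cos (real (Suc k) * t) + 1/2 * cos (real j * t))"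
    proof (rule ext)
      fix t :: real
      have "real (Suc k) * t = real k * t + t" "real j * t = real k * t - t"
        by (simp_all add: Suc algebra_simps)
      then show "cos t * cos (real k * t) = 1/2 * cos (real (Suc k) * t) + 1/2 * cos (real j * t)"
        by (simp only: cos_add cos_diff) (simp add: field_simps)
    qed
    moreover have "cos_poly (Suc n) (\<lambda>t. 1/2 * cos (real (Suc k) * t) + 1/2 * cos (real j * t))"
      using cos Suc by (intro cos_poly.intros) auto
    ultimately show ?thesis by (simp only:)
  qed
next
  case (add f g)
  then show ?case using cos_poly.add by (simp add: distrib_left)
next
  case (scale f c)
  then show ?case using cos_poly.scale[of "Suc n" "\<lambda>t. cos t * f t" c] by (simp add: mult.left_commute)
qed

text \<open>Horner's scheme: each multiplication by (1 - cos t) / 2 raises the frequency by at most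
  one. So polynomials of degree n on [0, 1] become even trigonometric polynomials of the same
  degree.\<close>

lemma cos_poly_poly:
  "degree P \<le> n \<Longrightarrow> cos_poly n (\<lambda>t. poly P ((1 - cos t) / 2))"
proof (induction n arbitrary: P)
  case 0
  then obtain a where "P = [:a:]" by (auto elim: degree_eq_zeroE)
  then show ?case using cos_poly.scale[OF cos_poly.cos[of 0 0], of a] by simp
next
  case (Suc n)
  obtain a Q where P: "P = pCons a Q" by (cases P)
  have "degree Q \<le> n" using Suc.prems P by (auto split: if_splits)
  then have Q: "cos_poly n (\<lambda>t. poly Q ((1 - cos t) / 2))" by (rule Suc.IH)
  have "cos_poly (Suc n) (\<lambda>t. a * cos (real 0 * t) + (1/2 * poly Q ((1 - cos t) / 2)
      + (-1/2) * (cos t * poly Q ((1 - cos t) / 2))))"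
    by (intro cos_poly.intros cos_poly_mult_cos[OF Q] cos_poly_Suc[OF Q]) auto
  then show ?case by (simp add: P algebra_simps diff_divide_distrib)
qed

lemma continuous_on_cos_poly: "cos_poly n f \<Longrightarrow> continuous_on A f"
  by (induction rule: cos_poly.induct) (auto intro!: continuous_intros)

text \<open>Endpoints at integer multiples of pi cover both [0, pi], used for orthogonality, and
  [-pi, pi], used for Bernstein's inequality.\<close>

lemma has_integral_cos_int:
  fixes m :: int
  assumes "m \<noteq> 0"
  shows "((\<lambda>t. cos (of_int m * t)) has_integral 0) {of_int a * pi..of_int b * pi}"
proof (cases "a \<le> b")
  case True
  have "((\<lambda>t. cos (of_int m * t)) has_integral
      sin (of_int m * (of_int b * pi)) / of_int m - sin (of_int m * (of_int a * pi)) / of_int m) {of_int a * pi..of_int b * pi}"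
    using assms True
    by (intro fundamental_theorem_of_calculus)
       (auto intro!: derivative_eq_intros simp flip: has_real_derivative_iff_has_vector_derivative)
  moreover have "sin (of_int m * (of_int j * pi)) = 0" for j
    by (subst sin_zero_iff_int2) (rule exI[of _ "m * j"], simp)
  ultimately show ?thesis by simp
next
  case False
  then have "{of_int a * pi..of_int b * pi} = {}" by (auto simp: not_le)
  then show ?thesis by (simp add: has_integral_empty_eq)
qed

lemma integral_cos_int:
  fixes m :: int
  assumes "a \<le> b"
  shows "integral {of_int a * pi..of_int b * pi} (\<lambda>t. cos (of_int m * t)) = (if m = 0 then of_int (b - a) * pi else 0)"
  using has_integral_cos_int[of m a b] assms
  by (auto intro!: integral_unique simp: algebra_simps)

lemma integral_fejer:
  assumes "a \<le> b"
  shows "integral {of_int a * pi..of_int b * pi} (fejer n) = real n * (of_int (b - a) * pi)"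
proof -
  have eq: "fejer n = (\<lambda>t. \<Sum>i<n. \<Sum>j<n. cos (of_int (int i - int j) * t))"
    by (simp add: fejer_eq fun_eq_iff)
  have "((\<lambda>t. \<Sum>i<n. \<Sum>j<n. cos (of_int (int i - int j) * t)) has_integral
      (\<Sum>i<n. \<Sum>j<n. integral {of_int a * pi..of_int b * pi} (\<lambda>t. cos (of_int (int i - int j) * t)))) {of_int a * pi..of_int b * pi}"
    by (intro has_integral_sum integrable_integral integrable_continuous_real continuous_intros) auto
  then have "integral {of_int a * pi..of_int b * pi} (fejer n)
      = (\<Sum>i<n. \<Sum>j<n. integral {of_int a * pi..of_int b * pi} (\<lambda>t. cos (of_int (int i - int j) * t)))"
    unfolding eq by (rule integral_unique)
  also have "\<dots> = (\<Sum>i<n. \<Sum>j<n. if i = j then of_int (b - a) * pi else 0)"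
    by (intro sum.cong refl) (simp only: integral_cos_int[OF assms], simp)
  also have "\<dots> = real n * (of_int (b - a) * pi)" by simp
  finally show ?thesis .
qed

text \<open>The trigonometric polynomial \<open>cos (2 n t) * fejer n t\<close> has only frequencies above \<open>n\<close>.\<close>

lemma integral_cos_poly_shifted_fejer:
  assumes "cos_poly n f" "n > 0"
  shows "((\<lambda>t. f t * (cos (2 * real n * t) * fejer n t)) has_integral 0) {0..pi}"
  using assms(1)
proof (induction rule: cos_poly.induct)
  case (cos k)
  \<comment> \<open>The product of three cosines has the frequencies 2 n + k and 2 n - k, each plus
    or minus i - j. With k \<le> n and |i - j| < n none of them is 0.\<close>
  have "((\<lambda>t. 1/4 * (cos (of_int (int k + 2 * n + (int i - int j)) * t) + cos (of_int (int k + 2 * n - (int i - int j)) * t)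
          + cos (of_int (2 * n - int k + (int i - int j)) * t) + cos (of_int (2 * n - int k - (int i - int j)) * t)))
        has_integral 1/4 * (0 + 0 + 0 + 0)) {of_int 0 * pi..of_int 1 * pi}" if "i < n" "j < n" for i j
    using that cos by (intro has_integral_mult_right has_integral_add has_integral_cos_int) auto
  moreover have "1/4 * (cos (of_int (int k + 2 * n + (int i - int j)) * t) + cos (of_int (int k + 2 * n - (int i - int j)) * t)
          + cos (of_int (2 * n - int k + (int i - int j)) * t) + cos (of_int (2 * n - int k - (int i - int j)) * t))
      = cos (real k * t) * (cos (2 * real n * t) * cos ((real i - real j) * t))" for i j t
  proof -
    have "1/4 * (cos (a + b + c) + cos (a + b - c) + cos (b - a + c) + cos (b - a - c)) = cos a * (cos b * cos c)" for a b c :: real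
      by (simp add: cos_add cos_diff sin_add sin_diff algebra_simps)
    from this[of "real k * t" "2 * real n * t" "(real i - real j) * t"] show ?thesis
      by (simp add: algebra_simps)
  qed
  ultimately have "((\<lambda>t. \<Sum>i<n. \<Sum>j<n. cos (real k * t) * (cos (2 * real n * t) * cos ((real i - real j) * t)))
      has_integral (\<Sum>i<n. \<Sum>j<n. 0)) {0..pi}"
    by (intro has_integral_sum) auto
  then show ?case by (simp add: fejer_eq sum_distrib_left)
next
  case (add f g)
  then show ?case using has_integral_add[OF add.IH] by (simp add: distrib_right)
next
  case (scale f c)
  then show ?case using has_integral_mult_right[OF scale.IH, of c] by (simp add: mult.assoc)
qed

text \<open>Since \<open>sin (n t) * fejer n t\<close> has the sine coefficients \<open>k\<close> for \<open>k \<le> n\<close>, convolution with it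
  differentiates trigonometric polynomials of degree \<open>n\<close>.\<close>

lemma cos_poly_has_derivative:
  assumes "cos_poly n f" "n > 0"
  shows "(f has_real_derivative 1 / pi * integral {-pi..pi} (\<lambda>t. f (x + t) * (sin (real n * t) * fejer n t))) (at x)"
  using assms(1)
proof (induction rule: cos_poly.induct)
  case (cos k)
  let ?I = "\<lambda>m. integral {of_int (-1) * pi..of_int 1 * pi} (\<lambda>t. cos (of_int m * t))"
  have I: "?I m = (if m = 0 then 2 * pi else 0)" for m
    using integral_cos_int[of "-1" 1 m] by simp
  \<comment> \<open>After the addition formula for cos (k (x + t)), this half is odd in
    \<open>t\<close>.\<close>
  have 1: "((\<lambda>t. cos (real k * x) * (cos (real k * t) * sin (real n * t) * fejer n t)) has_integral 0) {-pi..pi}"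
  proof -
    let ?g = "\<lambda>t. cos (real k * x) * (cos (real k * t) * sin (real n * t) * fejer n t)"
    have int: "?g integrable_on {-pi..pi}"
      by (intro integrable_continuous_real continuous_intros)
    have "integral {-pi..pi} ?g = integral {-pi..pi} (\<lambda>t. ?g (- t))"
      using Henstock_Kurzweil_Integration.integral_reflect_real[of pi "-pi" ?g] by simp
    also have "\<dots> = integral {-pi..pi} (\<lambda>t. - ?g t)" by simp
    also have "\<dots> = - integral {-pi..pi} ?g" by (rule integral_neg)
    finally have "integral {-pi..pi} ?g = 0" by linarith
    with integrable_integral[OF int] show ?thesis by (simp only:)
  qed
  \<comment> \<open>The frequencies n + k plus or minus (i - j) never vanish; the others vanish when
    i - j is n - k or k - n. Each of these differences occurs for exactly \<open>k\<close> pairs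
    below \<open>n\<close>, which produces the factor \<open>k\<close> of the derivative.\<close>
  have "((\<lambda>t. \<Sum>i<n. \<Sum>j<n. 1/4 * (cos (of_int (int k - n + (int i - int j)) * t) + cos (of_int (int k - n - (int i - int j)) * t)
          - cos (of_int (n + int k + (int i - int j)) * t) - cos (of_int (n + int k - (int i - int j)) * t)))
        has_integral (\<Sum>i<n. \<Sum>j<n. 1/4 * (?I (int k - n + (int i - int j)) + ?I (int k - n - (int i - int j))
          - ?I (n + int k + (int i - int j)) - ?I (n + int k - (int i - int j))))) {of_int (-1) * pi..of_int 1 * pi}"
    by (intro has_integral_sum has_integral_mult_right has_integral_add has_integral_diff integrable_integral
        integrable_continuous_real continuous_intros) auto
  also have "(\<lambda>t. \<Sum>i<n. \<Sum>j<n. 1/4 * (cos (of_int (int k - n + (int i - int j)) * t) + cos (of_int (int k - n - (int i - int j)) * t)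
          - cos (of_int (n + int k + (int i - int j)) * t) - cos (of_int (n + int k - (int i - int j)) * t)))
      = (\<lambda>t. sin (real k * t) * sin (real n * t) * fejer n t)"
  proof (rule ext)
    fix t
    have "1/4 * (cos (a - b + c) + cos (a - b - c) - cos (b + a + c) - cos (b + a - c)) = sin a * sin b * cos c" for a b c :: real
      by (simp add: cos_add cos_diff sin_add sin_diff algebra_simps)
    from this[of "real k * t" "real n * t" "(real i - real j) * t" for i j]
    show "(\<Sum>i<n. \<Sum>j<n. 1/4 * (cos (of_int (int k - n + (int i - int j)) * t) + cos (of_int (int k - n - (int i - int j)) * t)
          - cos (of_int (n + int k + (int i - int j)) * t) - cos (of_int (n + int k - (int i - int j)) * t)))
      = sin (real k * t) * sin (real n * t) * fejer n t"
      by (simp add: fejer_eq sum_distrib_left algebra_simps)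
  qed
  also have "(\<Sum>i<n. \<Sum>j<n. 1/4 * (?I (int k - n + (int i - int j)) + ?I (int k - n - (int i - int j))
          - ?I (n + int k + (int i - int j)) - ?I (n + int k - (int i - int j)))) = pi * real k"
  proof -
    have "(\<Sum>i<n. \<Sum>j<n. 1/4 * (?I (int k - n + (int i - int j)) + ?I (int k - n - (int i - int j))
          - ?I (n + int k + (int i - int j)) - ?I (n + int k - (int i - int j))))
      = (\<Sum>i<n. \<Sum>j<n. pi / 2 * ((if i + k = n + j then 1 else 0) + (if j + k = n + i then 1 else 0)))"
      unfolding I by (intro sum.cong refl) auto
    also have "\<dots> = pi / 2 * ((\<Sum>i<n. \<Sum>j<n. if i + k = n + j then 1 else 0) + (\<Sum>j<n. \<Sum>i<n. if j + k = n + i then 1 else 0))"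
      by (subst (3) sum.swap) (simp add: sum_distrib_left sum.distrib distrib_left)
    also have "(\<Sum>i<n. \<Sum>j<n. if i + k = n + j then 1 else 0) = real k"
    proof -
      have "(\<Sum>j<n. if i + k = n + j then 1 else 0) = (if n - k \<le> i then 1 else (0::real))" if "i < n" for i
      proof (cases "n - k \<le> i")
        case True
        have "(\<Sum>j<n. if i + k = n + j then 1 else (0::real)) = (\<Sum>j<n. if j = i + k - n then 1 else 0)"
          using True by (intro sum.cong) auto
        then show ?thesis using True that cos by simp
      qed (auto intro!: sum.neutral)
      then have "(\<Sum>i<n. \<Sum>j<n. if i + k = n + j then 1 else 0) = (\<Sum>i<n. if n - k \<le> i then 1 else (0::real))"
        by (intro sum.cong) auto
      also have "\<dots> = (\<Sum>i\<in>{n-k..<n}. 1)"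
        by (intro sum.mono_neutral_cong_right) auto
      finally show ?thesis using cos by simp
    qed
    finally show ?thesis by simp
  qed
  finally have 2: "((\<lambda>t. sin (real k * t) * sin (real n * t) * fejer n t) has_integral pi * real k) {-pi..pi}"
    by simp
  have "((\<lambda>t. cos (real k * (x + t)) * (sin (real n * t) * fejer n t)) has_integral 0 - sin (real k * x) * (pi * real k)) {-pi..pi}"
    using has_integral_diff[OF 1 has_integral_mult_right[OF 2, of "sin (real k * x)"]]
    by (simp add: cos_add algebra_simps)
  then have "integral {-pi..pi} (\<lambda>t. cos (real k * (x + t)) * (sin (real n * t) * fejer n t)) = - (pi * real k * sin (real k * x))"
    by (simp add: integral_unique mult_ac)
  then show ?case by (auto intro!: derivative_eq_intros)
next
  case (add f g)
  have int: "(\<lambda>t. h (x + t) * (sin (real n * t) * fejer n t)) integrable_on {-pi..pi}" if "cos_poly n h" for h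
  proof -
    have "continuous_on {-pi..pi} (\<lambda>t. h (x + t))"
      using continuous_on_cos_poly[OF that, of UNIV]
      by (rule continuous_on_compose2) (auto intro!: continuous_intros)
    then show ?thesis by (intro integrable_continuous_real continuous_intros)
  qed
  show ?case
    using DERIV_add[OF add.IH] integral_add[OF int[OF add.hyps(1)] int[OF add.hyps(2)]]
    by (simp add: distrib_left distrib_right)
next
  case (scale f c)
  then show ?case using DERIV_cmult[OF scale.IH, of c] by (simp add: mult.assoc mult.left_commute)
qed

text \<open>The differentiating kernel is bounded by \<open>fejer n\<close>, whose integral over
  [-pi, pi] is 2 pi n. Dividing by pi gives the constant 2 n, twice the sharp one; the mean value
  theorem does the rest.\<close>

lemma bernstein:
  assumes f: "cos_poly n f" and n: "n > 0" and M: "\<And>t. \<bar>f t\<bar> \<le> M" and x: "x \<ge> 0"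
  shows "\<bar>f x - f 0\<bar> \<le> 2 * real n * M * x"
proof -
  let ?g = "\<lambda>x t. f (x + t) * (sin (real n * t) * fejer n t)"
  have bound: "\<bar>1 / pi * integral {-pi..pi} (?g z)\<bar> \<le> 2 * real n * M" for z
  proof -
    have "continuous_on {-pi..pi} (\<lambda>t. f (z + t))"
      using continuous_on_cos_poly[OF f, of UNIV]
      by (rule continuous_on_compose2) (auto intro!: continuous_intros)
    then have "norm (integral {-pi..pi} (?g z)) \<le> integral {-pi..pi} (\<lambda>t. M * fejer n t)"
    proof (intro integral_norm_bound_integral integrable_continuous_real continuous_intros)
      fix t
      have "\<bar>f (z + t)\<bar> * (\<bar>sin (real n * t)\<bar> * fejer n t) \<le> M * (1 * fejer n t)"
        using M[of "z + t"] fejer_nonneg[of n t] by (intro mult_mono mult_nonneg_nonneg) auto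
      then show "norm (?g z t) \<le> M * fejer n t"
        using fejer_nonneg[of n t] by (simp add: abs_mult)
    qed
    also have "\<dots> = M * (real n * (2 * pi))"
      using integral_fejer[of "-1" 1 n] by simp
    finally show ?thesis by (simp add: abs_mult field_simps)
  qed
  show ?thesis
  proof (cases "x = 0")
    case False
    then have "0 < x" using x by simp
    from MVT2[OF this cos_poly_has_derivative[OF f n]] obtain z where
      "f x - f 0 = (x - 0) * (1 / pi * integral {-pi..pi} (?g z))" by blast
    then show ?thesis using bound[of z] x by (simp add: abs_mult mult.commute mult_left_mono del: times_divide_eq_left)
  qed simp
qed

section \<open>Lower bounds for powers\<close>

text \<open>The unnormalised Fourier cosine coefficient of sin (t / 2)^(2 g), the form that y^g
  takes in the variable t.\<close>

definition powr_cos_coeff :: "real \<Rightarrow> nat \<Rightarrow> real" where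
  "powr_cos_coeff g k = integral {0..pi} (\<lambda>t. ((1 - cos t) / 2) powr g * cos (real k * t))"

lemma continuous_on_powr_cos:
  assumes "g > 0"
  shows "continuous_on A (\<lambda>t::real. ((1 - cos t) / 2) powr g)"
  using assms by (intro continuous_on_powr' continuous_intros) auto

lemma powr_cos_coeff_has_integral:
  assumes "g > 0"
  shows "((\<lambda>t. ((1 - cos t) / 2) powr g * cos (real k * t)) has_integral powr_cos_coeff g k) {0..pi}"
  unfolding powr_cos_coeff_def using assms
  by (intro integrable_integral integrable_continuous_real continuous_intros continuous_on_powr_cos)

lemma powr_cos_coeff_Suc:
  assumes g: "g > 0"
  shows "(real k + g + 1) * powr_cos_coeff g (Suc k) = (real k - g) * powr_cos_coeff g k"
proof -
  \<comment> \<open>The antiderivative behind the recurrence: the derivative of \<open>F\<close> is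
    a combination of the integrands for \<open>k\<close> and k + 1, while \<open>F\<close> vanishes
    at 0 through the sine and at pi through the cosine.\<close>
  define F where "F = (\<lambda>t. sin (t / 2) powr (2 * g + 1) * cos ((real k + 1/2) * t))"
  define h where "h = (\<lambda>t. 1/2 * ((g - real k) * (((1 - cos t) / 2) powr g * cos (real k * t))
      + (real k + g + 1) * (((1 - cos t) / 2) powr g * cos (real (Suc k) * t))))"
  have hF: "(h has_integral F pi - F 0) {0..pi}"
  proof (rule fundamental_theorem_of_calculus_interior)
    show "continuous_on {0..pi} F"
      unfolding F_def using g by (intro continuous_intros continuous_on_powr') (auto intro!: sin_ge_zero)
    fix t :: real assume t: "t \<in> {0<..<pi}"
    define s c where "s = sin (t / 2)" and "c = cos (t / 2)"
    define a where "a = (real k + 1/2) * t"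
    have s: "s > 0" unfolding s_def using t by (intro sin_gt_zero) auto
    have "(F has_real_derivative
        ((2 * g + 1) * s powr (2 * g) * (c / 2)) * cos a - s powr (2 * g + 1) * ((real k + 1/2) * sin a)) (at t)"
      unfolding F_def a_def using s unfolding s_def c_def
      by (auto intro!: derivative_eq_intros)
    moreover have "((2 * g + 1) * s powr (2 * g) * (c / 2)) * cos a - s powr (2 * g + 1) * ((real k + 1/2) * sin a) = h t"
    proof -
      have y: "(1 - cos t) / 2 = s powr 2"
        using s cos_double_sin[of "t / 2"] by (simp add: s_def powr_numeral)
      have k: "real k * t = a - t / 2" "real (Suc k) * t = a + t / 2"
        by (simp_all add: a_def algebra_simps)
      show ?thesis
        unfolding h_def y powr_powr k cos_add cos_diff using s
        by (simp add: s_def[symmetric] c_def[symmetric] powr_add field_simps)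
    qed
    ultimately show "(F has_vector_derivative h t) (at t)"
      by (simp add: has_real_derivative_iff_has_vector_derivative)
  qed auto
  have F0: "F 0 = 0" by (simp add: F_def)
  have Fpi: "F pi = 0"
  proof -
    have "cos ((real k + 1/2) * pi) = 0"
      using cos_zero_iff_int[of "(real k + 1/2) * pi"]
      by (auto simp: algebra_simps intro!: exI[of _ "2 * int k + 1"])
    then show ?thesis by (simp add: F_def)
  qed
  have "(h has_integral 1/2 * ((g - real k) * powr_cos_coeff g k + (real k + g + 1) * powr_cos_coeff g (Suc k))) {0..pi}"
    unfolding h_def
    by (intro has_integral_mult_right has_integral_add powr_cos_coeff_has_integral g)
  from has_integral_unique[OF this hF]
  have "1/2 * ((g - real k) * powr_cos_coeff g k + (real k + g + 1) * powr_cos_coeff g (Suc k)) = 0"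
    by (simp only: F0 Fpi diff_self)
  then show ?thesis by (simp add: algebra_simps)
qed

lemma powr_cos_coeff_0_pos:
  assumes g: "g > 0"
  shows "powr_cos_coeff g 0 > 0"
proof -
  have eq: "powr_cos_coeff g 0 = integral {0..pi} (\<lambda>t. ((1 - cos t) / 2) powr g)"
    by (simp add: powr_cos_coeff_def)
  have "powr_cos_coeff g 0 \<ge> 0"
    unfolding eq by (intro integral_nonneg integrable_continuous_real continuous_on_powr_cos g) auto
  moreover have "powr_cos_coeff g 0 \<noteq> 0"
    unfolding eq by (subst integral_eq_0_iff) (auto intro!: continuous_on_powr_cos g bexI[of _ pi])
  ultimately show ?thesis by simp
qed

lemma powr_ge_one_plus:
  fixes u p :: real
  assumes "u \<ge> 0" "p \<ge> 1"
  shows "1 + p * u \<le> (1 + u) powr p"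
proof -
  have "(1 + 0) powr p - p * 0 \<le> (1 + u) powr p - p * u"
  proof (rule DERIV_nonneg_imp_nondecreasing[OF assms(1)])
    fix x :: real assume x: "0 \<le> x"
    have "((\<lambda>x. (1 + x) powr p - p * x) has_real_derivative p * (1 + x) powr (p - 1) - p) (at x)"
      using x by (auto intro!: derivative_eq_intros)
    moreover have "(1 + x) powr (p - 1) \<ge> 1"
      using x assms ge_one_powr_ge_zero[of "1 + x" "p - 1"] by simp
    then have "p * (1 + x) powr (p - 1) - p \<ge> 0"
      using mult_left_mono[of 1 "(1 + x) powr (p - 1)" p] assms by simp
    ultimately show "\<exists>d. ((\<lambda>x. (1 + x) powr p - p * x) has_real_derivative d) (at x) \<and> 0 \<le> d"
      by blast
  qed
  then show ?thesis by simp
qed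

text \<open>The ratio (k - g) / (k + g + 1) is never 0 for noninteger \<open>g\<close> and is
  positive once k > g, so the sign freezes. From then on, Bernoulli's inequality
  \<open>powr_ge_one_plus\<close> makes the coefficient times (k - g)^(2 g + 1) nondecreasing in
  absolute value.\<close>

lemma powr_cos_coeff_lower_bound:
  assumes g: "g > 0" and nat: "\<forall>j. g \<noteq> real j"
  obtains c s :: real and K :: nat where "c > 0" "\<bar>s\<bar> = 1" "K > 0"
    "\<And>k. k \<ge> K \<Longrightarrow> s * powr_cos_coeff g k \<ge> c * real k powr (- (2 * g + 1))"
proof -
  define p where "p = 2 * g + 1"
  obtain K :: nat where K: "g < real K" using reals_Archimedean2 by blast
  let ?A = "powr_cos_coeff g"
  have A0: "?A k \<noteq> 0" for k
  proof (induction k)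
    case 0
    show ?case using powr_cos_coeff_0_pos[OF g] by simp
  next
    case (Suc k)
    then show ?case using powr_cos_coeff_Suc[OF g, of k] nat by auto
  qed
  define s where "s = sgn (?A K)"
  have s: "\<bar>s\<bar> = 1" using A0[of K] by (simp add: s_def abs_sgn_eq)
  define c where "c = s * ?A K * (real K - g) powr p"
  have "s * ?A K = \<bar>?A K\<bar>" by (simp add: s_def abs_sgn mult.commute)
  then have c: "c > 0" using A0[of K] K by (simp add: c_def)
  have *: "s * ?A k * (real k - g) powr p \<ge> c" if "k \<ge> K" for k
    using that
  proof (induction k rule: dec_induct)
    case base
    show ?case by (simp add: c_def)
  next
    case (step k)
    define x where "x = real k - g"
    have x: "x > 0" using step K by (simp add: x_def)
    have "1 + p * (1 / x) \<le> (1 + 1 / x) powr p"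
      using x g by (intro powr_ge_one_plus) (auto simp: p_def)
    then have "x / (x + p) * ((x + 1) powr p) \<ge> x powr p"
    proof -
      have "x powr p * (1 + p * (1 / x)) \<le> x powr p * (1 + 1 / x) powr p"
        using \<open>1 + p * (1 / x) \<le> _\<close> by (intro mult_left_mono) auto
      also have "\<dots> = (x * (1 + 1 / x)) powr p" by (rule powr_mult[symmetric])
      also have "x * (1 + 1 / x) = x + 1" using x by (simp add: field_simps)
      finally have "x powr p * ((x + p) / x) \<le> (x + 1) powr p"
        using x by (simp add: field_simps)
      then show ?thesis using x g by (simp add: p_def field_simps)
    qed
    moreover have pos: "s * ?A k \<ge> 0"
      using step.IH c x by (smt (verit) mult_nonpos_nonneg powr_ge_zero)
    moreover have "?A (Suc k) = x / (x + p) * ?A k"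
      using powr_cos_coeff_Suc[OF g, of k] g x by (simp add: x_def p_def field_simps)
    moreover have "real (Suc k) - g = x + 1" by (simp add: x_def)
    ultimately have "s * ?A (Suc k) * (real (Suc k) - g) powr p \<ge> s * ?A k * x powr p"
      using mult_left_mono[of "x powr p" "x / (x + p) * (x + 1) powr p" "s * ?A k"]
      by (simp add: mult_ac del: of_nat_Suc)
    then show ?case using step.IH unfolding x_def by linarith
  qed
  have "s * ?A k \<ge> c * real k powr (- p)" if k: "k \<ge> K" for k
  proof -
    have kg: "real k - g > 0" using k K by simp
    have "c \<le> s * ?A k * (real k - g) powr p" by (rule *[OF k])
    also have "\<dots> \<le> s * ?A k * real k powr p"
    proof (intro mult_left_mono powr_mono2)
      show "s * ?A k \<ge> 0"
        using *[OF k] c kg by (smt (verit) mult_nonpos_nonneg powr_ge_zero)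
    qed (use g kg p_def in auto)
    finally show ?thesis using kg g by (simp add: powr_minus field_simps)
  qed
  moreover have "K > 0" using K g by (cases K) auto
  ultimately show ?thesis using that c s unfolding p_def by blast
qed

text \<open>Duality: the weight \<open>W\<close> annihilates \<open>P\<close> and has mass at most n
  pi, so e n pi bounds the integral of y^g against \<open>W\<close>. That integral adds up n^2
  coefficients of equal sign and size at least of order n^(-2 g - 1); dividing by n leaves n^(-2
  g).\<close>

lemma powr_approx_error_ge:
  assumes g: "g > 0" and nat: "\<forall>j. g \<noteq> real j"
  obtains c :: real and N :: nat where "c > 0" "N > 0"
    "\<And>n P e. n \<ge> N \<Longrightarrow> degree P \<le> n \<Longrightarrow> (\<And>y. y \<in> {0..1} \<Longrightarrow> \<bar>poly P y - y powr g\<bar> \<le> e)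
      \<Longrightarrow> e \<ge> c * real n powr (- (2 * g))"
proof -
  define p where "p = 2 * g + 1"
  obtain c s :: real and N :: nat where c: "c > 0" and s: "\<bar>s\<bar> = 1" and N: "N > 0"
    and lower: "\<And>k. k \<ge> N \<Longrightarrow> s * powr_cos_coeff g k \<ge> c * real k powr (- p)"
    using powr_cos_coeff_lower_bound[OF g nat] unfolding p_def by metis
  define c' where "c' = c * 3 powr (- p) / pi"
  have "e \<ge> c' * real n powr (- (2 * g))"
    if n: "n \<ge> N" and deg: "degree P \<le> n" and P: "\<And>y. y \<in> {0..1} \<Longrightarrow> \<bar>poly P y - y powr g\<bar> \<le> e" for n P e
  proof -
    have n0: "n > 0" using n N by simp
    define y where "y = (\<lambda>t::real. (1 - cos t) / 2)"
    define W where "W = (\<lambda>t. cos (2 * real n * t) * fejer n t)"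
    \<comment> \<open>The subtractions on naturals are exact, as i and j are below 2 n.\<close>
    define L where "L = (\<Sum>i<n. \<Sum>j<n. 1/2 * (powr_cos_coeff g (2 * n + i - j) + powr_cos_coeff g (2 * n + j - i)))"
    have "((\<lambda>t. \<Sum>i<n. \<Sum>j<n. 1/2 * (y t powr g * cos (real (2 * n + i - j) * t) + y t powr g * cos (real (2 * n + j - i) * t)))
        has_integral L) {0..pi}"
      unfolding L_def y_def
      by (intro has_integral_sum has_integral_mult_right has_integral_add powr_cos_coeff_has_integral g) auto
    moreover have "(\<Sum>i<n. \<Sum>j<n. 1/2 * (y t powr g * cos (real (2 * n + i - j) * t) + y t powr g * cos (real (2 * n + j - i) * t)))
        = y t powr g * W t" for t
    proof -
      have "1/2 * (y t powr g * cos (real (2 * n + i - j) * t) + y t powr g * cos (real (2 * n + j - i) * t))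
          = y t powr g * (cos (2 * real n * t) * cos ((real i - real j) * t))" if "i < n" "j < n" for i j
      proof -
        have r: "real (2 * n + i - j) * t = 2 * real n * t + (real i - real j) * t"
          "real (2 * n + j - i) * t = 2 * real n * t - (real i - real j) * t"
          using that by (simp_all add: of_nat_diff algebra_simps)
        show ?thesis unfolding r cos_add cos_diff by algebra
      qed
      then have "(\<Sum>i<n. \<Sum>j<n. 1/2 * (y t powr g * cos (real (2 * n + i - j) * t) + y t powr g * cos (real (2 * n + j - i) * t)))
          = (\<Sum>i<n. \<Sum>j<n. y t powr g * (cos (2 * real n * t) * cos ((real i - real j) * t)))"
        by (intro sum.cong refl) auto
      then show ?thesis by (simp add: W_def fejer_eq sum_distrib_left)
    qed
    ultimately have "((\<lambda>t. y t powr g * W t) has_integral L) {0..pi}" by simp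
    moreover have "((\<lambda>t. poly P (y t) * W t) has_integral 0) {0..pi}"
      unfolding y_def W_def by (intro integral_cos_poly_shifted_fejer cos_poly_poly deg n0)
    ultimately have int: "((\<lambda>t. poly P (y t) * W t - y t powr g * W t) has_integral 0 - L) {0..pi}"
      by (intro has_integral_diff)
    have "norm (integral {0..pi} (\<lambda>t. poly P (y t) * W t - y t powr g * W t)) \<le> integral {0..pi} (\<lambda>t. e * fejer n t)"
    proof (rule integral_norm_bound_integral)
      show "(\<lambda>t. poly P (y t) * W t - y t powr g * W t) integrable_on {0..pi}"
        using int by (rule has_integral_integrable)
      show "(\<lambda>t. e * fejer n t) integrable_on {0..pi}"
        by (intro integrable_continuous_real continuous_intros)
      fix t :: real
      have "y t \<in> {0..1}" using cos_ge_minus_one[of t] cos_le_one[of t] by (simp add: y_def del: cos_ge_minus_one cos_le_one)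
      then have "\<bar>poly P (y t) - y t powr g\<bar> * (\<bar>cos (2 * real n * t)\<bar> * fejer n t) \<le> e * (1 * fejer n t)"
        using P[of "y t"] fejer_nonneg[of n t] by (intro mult_mono mult_nonneg_nonneg) auto
      then show "norm (poly P (y t) * W t - y t powr g * W t) \<le> e * fejer n t"
        using fejer_nonneg[of n t] by (simp add: W_def abs_mult flip: left_diff_distrib)
    qed
    also have "\<dots> = e * (real n * pi)"
      using integral_fejer[of 0 1 n] by simp
    finally have upper: "\<bar>L\<bar> \<le> e * (real n * pi)"
      using int by (simp add: integral_unique)
    have avg: "z \<le> 1/2 * (u + v)" if "z \<le> u" "z \<le> v" for z u v :: real
      using that by (simp add: field_simps)
    \<comment> \<open>All indices in \<open>L\<close> lie between n and 3 n: the lower end is past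
      the threshold \<open>N\<close>, the upper end accounts for the constant 3 powr (- p).\<close>
    have each: "s * powr_cos_coeff g k \<ge> c * (3 * real n) powr (- p)" if "n \<le> k" "k \<le> 3 * n" for k
    proof -
      have "(3 * real n) powr (- p) \<le> real k powr (- p)"
        using that n0 g by (intro powr_mono2') (auto simp: p_def)
      then have "c * (3 * real n) powr (- p) \<le> c * real k powr (- p)"
        using c by (intro mult_left_mono) auto
      also have "\<dots> \<le> s * powr_cos_coeff g k" using that n by (intro lower) auto
      finally show ?thesis .
    qed
    have "real n * (real n * (c * (3 * real n) powr (- p))) = (\<Sum>i<n. \<Sum>j<n. c * (3 * real n) powr (- p))"
      by simp
    also have "\<dots> \<le> (\<Sum>i<n. \<Sum>j<n. 1/2 * (s * powr_cos_coeff g (2 * n + i - j) + s * powr_cos_coeff g (2 * n + j - i)))"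
    proof (intro sum_mono)
      fix i j assume "i \<in> {..<n}" "j \<in> {..<n}"
      then have ij: "n \<le> 2 * n + i - j" "2 * n + i - j \<le> 3 * n" "n \<le> 2 * n + j - i" "2 * n + j - i \<le> 3 * n"
        by auto
      show "c * (3 * real n) powr (- p) \<le> 1/2 * (s * powr_cos_coeff g (2 * n + i - j) + s * powr_cos_coeff g (2 * n + j - i))"
        by (rule avg[OF each[OF ij(1,2)] each[OF ij(3,4)]])
    qed
    also have "\<dots> = s * L" by (simp add: L_def sum_distrib_left algebra_simps)
    also have "\<dots> \<le> \<bar>L\<bar>" using s abs_ge_self[of "s * L"] by (simp add: abs_mult del: abs_ge_self)
    also have "\<dots> \<le> e * (real n * pi)" by (rule upper)
    finally have "real n * (real n * (c * (3 * real n) powr (- p))) \<le> real n * (e * pi)" by (simp add: mult_ac)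
    then have "real n * (c * (3 * real n) powr (- p)) \<le> e * pi" using n0 by simp
    moreover have "(3 * real n) powr (- p) = 3 powr (- p) * real n powr (- p)"
      by (rule powr_mult)
    moreover have "real n powr (- (2 * g)) = real n * real n powr (- p)"
      using n0 by (simp add: p_def powr_diff powr_minus)
    ultimately show ?thesis by (simp add: c'_def field_simps)
  qed
  moreover have "c' > 0" using c by (simp add: c'_def)
  ultimately show ?thesis using that N by blast
qed

section \<open>Fixed error\<close>

text \<open>For the Legendre polynomial \<open>q\<close>, the polynomial \<open>1 - q y / q (- 1 / A)\<close> is divisible by \<open>1 + A y\<close>,
  and \<open>q (- 1 / A)\<close> is at least its linear term.\<close>

lemma inverse_linear_approx:
  assumes A: "A > 0" and n: "n > 0"
  shows "\<exists>V :: real poly. degree V \<le> n \<and>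
    (\<forall>y\<in>{0..1}. \<bar>poly V y - 1 / (1 + A * y)\<bar> \<le> A / (real n * (real n + 1)))"
proof -
  define a where "a = 1 / A"
  have a: "a > 0" using A by (simp add: a_def)
  let ?q = "legendre n"
  define Q where "Q = poly ?q (- a)"
  have trm: "legendre_coeff n k * (- a) ^ k = real (n choose k) * real ((n + k) choose k) * a ^ k" for k
  proof -
    have "(-1) ^ k * (- a) ^ k = a ^ k" by (simp flip: power_mult_distrib)
    moreover have "legendre_coeff n k * (- a) ^ k = real (n choose k) * real ((n + k) choose k) * ((-1) ^ k * (- a) ^ k)"
      by (simp add: legendre_coeff_def)
    ultimately show ?thesis by (simp only:)
  qed
  \<comment> \<open>To the left of 0 the alternating signs cancel and all terms are nonnegative, so
    a single one bounds the sum from below.\<close>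
  have "legendre_coeff n 1 * (- a) ^ 1 \<le> (\<Sum>k\<le>n. legendre_coeff n k * (- a) ^ k)"
    using n a by (intro member_le_sum) (auto simp: trm simp del: One_nat_def)
  also have "\<dots> = Q" by (simp add: Q_def poly_legendre)
  finally have Q: "real n * (real n + 1) * a \<le> Q" by (simp add: legendre_coeff_def algebra_simps)
  moreover have "real n * (real n + 1) * a > 0" using n a by simp
  ultimately have Q0: "Q > 0" by linarith
  define U where "U = 1 - smult (1 / Q) ?q"
  have "poly U (- a) = 0" using Q0 by (simp add: U_def Q_def)
  then obtain W where W: "U = [:a, 1:] * W" by (auto simp: poly_eq_0_iff_dvd dvd_def)
  have "degree U \<le> n" unfolding U_def
    by (intro degree_diff_le) (auto intro: degree_legendre)
  moreover have "degree U = 1 + degree W" if "W \<noteq> 0"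
    unfolding W using that by (subst degree_mult_eq) auto
  ultimately have "degree W \<le> n" by (cases "W = 0") auto
  moreover have "\<bar>poly (smult a W) y - 1 / (1 + A * y)\<bar> \<le> A / (real n * (real n + 1))" if y: "y \<in> {0..1}" for y
  proof -
    have "(a + y) * poly W y = 1 - poly ?q y / Q"
      using arg_cong[OF W, of "\<lambda>p. poly p y"] by (simp add: U_def algebra_simps)
    moreover have pos: "a + y > 0" "1 + A * y \<ge> 1" using a A y by auto
    moreover have "a * (1 + A * y) = a + y" using A by (simp add: a_def field_simps)
    ultimately have "poly (smult a W) y * (1 + A * y) = 1 - poly ?q y / Q"
      by (metis poly_smult mult.assoc mult.commute)
    then have "poly (smult a W) y = (1 - poly ?q y / Q) / (1 + A * y)"
      using pos by (simp add: eq_divide_eq)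
    then have "poly (smult a W) y - 1 / (1 + A * y) = - (poly ?q y / Q / (1 + A * y))"
      by (simp add: diff_divide_distrib)
    also have "\<bar>\<dots>\<bar> \<le> 1 / Q / 1"
      using pos Q0 y abs_legendre_le_1[of y n] by (auto simp: abs_mult intro!: frac_le divide_right_mono)
    also have "\<dots> \<le> 1 / (real n * (real n + 1) * a)"
      using Q Q0 n a by (auto intro!: frac_le)
    also have "\<dots> = A / (real n * (real n + 1))" by (simp add: a_def)
    finally show ?thesis .
  qed
  ultimately show ?thesis by (intro exI[of _ "smult a W"]) auto
qed

text \<open>Since \<open>exp (- u powr \<beta>)\<close> is a continuous function of \<open>1 / (1 + u) \<in> [0, 1]\<close>, the Weierstrass
  theorem reduces the approximation of \<open>exp (- (A y) powr \<beta>)\<close> to that of \<open>1 / (1 + A y)\<close>.\<close>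

lemma approximable_fixed_error:
  assumes b: "\<beta> > 0" and e: "\<epsilon> > 0"
  obtains C where "C > 0" "\<And>\<tau>. \<tau> \<ge> 1 \<Longrightarrow> \<exists>d. real d \<le> C * \<tau> powr (1 / (2 * \<beta>)) \<and> approximable \<beta> \<tau> \<epsilon> d"
proof -
  \<comment> \<open>With v = 1 / (1 + u) one has u = (1 - v) / v; the value 0 at v = 0 is the limit
    for u to infinity and makes \<phi> continuous on the compact interval.\<close>
  define \<phi> where "\<phi> = (\<lambda>v::real. if v = 0 then 0 else exp (- (((1 - v) / v) powr \<beta>)))"
  have "continuous_on {0..1} \<phi>"
  proof (rule continuous_on_IccI)
    have "((\<lambda>v::real. exp (- (((1 - v) / v) powr \<beta>))) \<longlongrightarrow> 0) (at_right 0)"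
      using b by real_asymp
    then show "(\<phi> \<longlongrightarrow> \<phi> 0) (at_right 0)"
      unfolding \<phi>_def by (simp, rule Lim_transform_eventually) (auto simp: eventually_at_filter)
    have "isCont (\<lambda>v::real. exp (- (((1 - v) / v) powr \<beta>))) x" if "0 < x" "x < 1" for x
      using that by (intro continuous_intros) auto
    then have "isCont \<phi> x" if "0 < x" "x < 1" for x
      using that
      by (subst isCont_cong[where g = "\<lambda>v. exp (- (((1 - v) / v) powr \<beta>))"])
         (auto simp: \<phi>_def eventually_nhds intro!: exI[of _ "{0<..}"])
    then show "(\<phi> \<longlongrightarrow> \<phi> x) (at x)" if "0 < x" "x < 1" for x using that by (simp add: isCont_def)
    have "((\<lambda>v::real. exp (- (((1 - v) / v) powr \<beta>))) \<longlongrightarrow> 1) (at_left 1)"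
      using b by real_asymp
    then show "(\<phi> \<longlongrightarrow> \<phi> 1) (at_left 1)"
      unfolding \<phi>_def
      by (simp, rule Lim_transform_eventually)
         (use eventually_at_left_real[of 0 "1::real"] in \<open>auto elim!: eventually_mono\<close>)
  qed auto
  then obtain p0 where p0: "real_polynomial_function p0" "\<And>v. v \<in> {0..1} \<Longrightarrow> \<bar>\<phi> v - p0 v\<bar> < \<epsilon> / 2"
    using Stone_Weierstrass_real_polynomial_function[of "{0..1}" \<phi> "\<epsilon> / 2"] e by auto
  then obtain ca N where ca: "p0 = (\<lambda>x. \<Sum>i\<le>N. ca i * x ^ i)"
    unfolding real_polynomial_function_iff_sum by blast
  define p where "p = (\<Sum>i\<le>N. monom (ca i) i)"
  have p: "poly p = p0" by (auto simp: p_def ca poly_sum poly_monom)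
  \<comment> \<open>The approximation of v may leave [0, 1], but by at most \<eta> \<le> 1, so it
    stays in this larger interval.\<close>
  have "uniformly_continuous_on {-1..2} (poly p)"
    by (intro compact_uniformly_continuous continuous_intros) auto
  then obtain \<delta> where \<delta>: "\<delta> > 0" "\<And>x y. x \<in> {-1..2} \<Longrightarrow> y \<in> {-1..2} \<Longrightarrow> \<bar>y - x\<bar> < \<delta> \<Longrightarrow> \<bar>poly p y - poly p x\<bar> < \<epsilon> / 2"
    unfolding uniformly_continuous_on_def dist_real_def using e by (meson half_gt_zero)
  define \<eta> where "\<eta> = min 1 (\<delta> / 2)"
  have \<eta>: "0 < \<eta>" "\<eta> \<le> 1" "\<eta> < \<delta>" using \<delta>(1) by (auto simp: \<eta>_def)
  define D where "D = real (degree p) + 1"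
  define C where "C = D * (1 / sqrt \<eta> + 1)"
  have "\<exists>d. real d \<le> C * \<tau> powr (1 / (2 * \<beta>)) \<and> approximable \<beta> \<tau> \<epsilon> d" if \<tau>: "\<tau> \<ge> 1" for \<tau>
  proof -
    \<comment> \<open>This turns \<tau> y^\<beta> into (A y)^\<beta>. A degree of order sqrt A =
      \<tau>^(1 / (2 \<beta>)) reaches the accuracy \<eta>, and the outer polynomial
      \<open>p\<close> does not depend on \<tau>.\<close>
    define A where "A = \<tau> powr (1 / \<beta>)"
    have A: "A \<ge> 1" using \<tau> b by (simp add: A_def ge_one_powr_ge_zero)
    have sqA: "sqrt A = \<tau> powr (1 / (2 * \<beta>))"
      using \<tau> by (simp add: A_def powr_half_sqrt[symmetric] powr_powr mult.commute)
    define n where "n = nat \<lceil>sqrt (A / \<eta>)\<rceil>"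
    have n1: "sqrt (A / \<eta>) \<le> real n" by (simp add: n_def; linarith)
    have n2: "real n \<le> sqrt A * (1 / sqrt \<eta> + 1)"
    proof -
      have "real n \<le> sqrt (A / \<eta>) + 1" using A \<eta> by (simp add: n_def; linarith)
      also have "\<dots> \<le> sqrt A * (1 / sqrt \<eta> + 1)" using A by (simp add: real_sqrt_divide algebra_simps)
      finally show ?thesis .
    qed
    have "sqrt (A / \<eta>) > 0" using A \<eta> by simp
    then have n0: "n > 0" using n1 by (cases n) auto
    obtain V where V: "degree V \<le> n" "\<And>y. y \<in> {0..1} \<Longrightarrow> \<bar>poly V y - 1 / (1 + A * y)\<bar> \<le> A / (real n * (real n + 1))"
      using inverse_linear_approx[of A n] A n0 by auto
    have "A / (real n * (real n + 1)) \<le> \<eta>"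
    proof -
      have "A / \<eta> = (sqrt (A / \<eta>))\<^sup>2" using A \<eta> by simp
      also have "\<dots> \<le> (real n)\<^sup>2" using n1 A \<eta> by (intro power_mono) auto
      also have "\<dots> \<le> real n * (real n + 1)" by (simp add: power2_eq_square distrib_left)
      finally have "A \<le> \<eta> * (real n * (real n + 1))"
        using \<eta> by (simp add: pos_divide_le_eq mult.commute)
      moreover have "real n * (real n + 1) > 0" using n0 by simp
      ultimately show ?thesis by (simp only: pos_divide_le_eq)
    qed
    with V have V2: "\<bar>poly V y - 1 / (1 + A * y)\<bar> \<le> \<eta>" if "y \<in> {0..1}" for y
      using that by (meson order_trans)
    let ?R = "pcompose p V"
    have "real (degree ?R) \<le> real (degree p * n)"
      unfolding of_nat_le_iff using V(1) degree_pcompose_le[of p V] by (meson mult_le_mono2 order_trans)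
    also have "\<dots> \<le> D * real n" by (simp add: D_def mult_right_mono)
    also have "\<dots> \<le> C * \<tau> powr (1 / (2 * \<beta>))"
      using n2 mult_left_mono[of "real n" "sqrt A * (1 / sqrt \<eta> + 1)" D] by (simp add: C_def D_def mult_ac sqA)
    finally have "real (degree ?R) \<le> C * \<tau> powr (1 / (2 * \<beta>))" .
    moreover have "\<bar>poly ?R y - exp (- \<tau> * y powr \<beta>)\<bar> \<le> \<epsilon>" if y: "y \<in> {0..1}" for y
    proof -
      define v where "v = 1 / (1 + A * y)"
      have v: "0 < v" "v \<le> 1" using y A by (auto simp: v_def add_pos_nonneg)
      have "1 + A * y > 0" using y A by (auto intro: add_pos_nonneg)
      then have "(1 - v) / v = A * y" by (simp add: v_def field_simps)
      moreover have "(A * y) powr \<beta> = \<tau> * y powr \<beta>"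
        using \<tau> b by (simp add: powr_mult A_def powr_powr)
      ultimately have "\<phi> v = exp (- \<tau> * y powr \<beta>)" using v by (simp add: \<phi>_def)
      moreover have "\<bar>\<phi> v - poly p v\<bar> < \<epsilon> / 2" using p0(2)[of v] v by (simp add: p)
      moreover have "\<bar>poly p (poly V y) - poly p v\<bar> < \<epsilon> / 2"
      proof (rule \<delta>(2))
        have Vv: "\<bar>poly V y - v\<bar> \<le> \<eta>" using V2[OF y] by (simp add: v_def)
        then show "poly V y \<in> {-1..2}" "\<bar>poly V y - v\<bar> < \<delta>"
          using v \<eta> by (auto simp: abs_le_iff)
      qed (use v in auto)
      moreover have "\<bar>poly p (poly V y) - \<phi> v\<bar> \<le> \<bar>poly p (poly V y) - poly p v\<bar> + \<bar>\<phi> v - poly p v\<bar>"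
        using abs_triangle_ineq4[of "poly p (poly V y) - poly p v" "\<phi> v - poly p v"] by simp
      ultimately show ?thesis by (simp add: poly_pcompose field_simps)
    qed
    ultimately show ?thesis unfolding approximable_def by blast
  qed
  moreover have "C > 0" using \<eta> by (simp add: C_def D_def add_pos_nonneg mult_pos_pos)
  ultimately show ?thesis using that by blast
qed

lemma sin_ge_half:
  fixes x :: real
  assumes "0 \<le> x" "x \<le> 1"
  shows "x / 2 \<le> sin x"
proof -
  have "sin 0 - 0 / 2 \<le> sin x - x / 2"
  proof (rule DERIV_nonneg_imp_nondecreasing[OF assms(1)])
    fix z assume z: "0 \<le> z" "z \<le> x"
    have "cos (pi / 3) \<le> cos z"
      using z assms pi_gt3 by (intro cos_monotone_0_pi_le) auto
    then have "cos z - 1 / 2 \<ge> 0" by (simp add: cos_60)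
    moreover have "((\<lambda>x. sin x - x / 2) has_real_derivative cos z - 1 / 2) (at z)"
      by (auto intro!: derivative_eq_intros)
    ultimately show "\<exists>d. ((\<lambda>x. sin x - x / 2) has_real_derivative d) (at z) \<and> 0 \<le> d" by blast
  qed
  then show ?thesis by simp
qed

text \<open>At t = 4 / g, with g = \<tau>^(1 / (2 \<beta>)), the target has fallen from 1 to at most
  exp (- 1), because y = sin (2 / g)^2 is at least 1 / g^2. The bound on \<epsilon> leaves the
  polynomial at least half of this drop, while \<open>bernstein\<close> allows at most 16 (d + 1) /
  g; hence the 32. The condition g \<ge> 2 keeps 2 / g in the range of
  \<open>sin_ge_half\<close>.\<close>

lemma approximable_fixed_error_lower:
  assumes b: "\<beta> > 0" and e: "0 < \<epsilon>" "\<epsilon> < (1 - exp (- 1)) / 4"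
    and \<tau>: "\<tau> powr (1 / (2 * \<beta>)) \<ge> 2" "\<tau> > 0" and adm: "approximable \<beta> \<tau> \<epsilon> d"
  shows "real d + 1 \<ge> (1 - exp (- 1)) / 32 * \<tau> powr (1 / (2 * \<beta>))"
proof -
  obtain R :: "real poly" where R: "degree R \<le> d"
    "\<And>y. y \<in> {0..1} \<Longrightarrow> \<bar>poly R y - exp (- \<tau> * y powr \<beta>)\<bar> \<le> \<epsilon>"
    using adm unfolding approximable_def by blast
  have e4: "4 * \<epsilon> < 1 - exp (- 1)" using e by (simp add: field_simps)
  define g where "g = \<tau> powr (1 / (2 * \<beta>))"
  have g: "g \<ge> 2" using \<tau> by (simp add: g_def)
  define f where "f = (\<lambda>t::real. poly R ((1 - cos t) / 2))"
  have Y: "(1 - cos t) / 2 \<in> {0..1}" for t :: real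
    using cos_ge_minus_one[of t] cos_le_one[of t] by (simp del: cos_ge_minus_one cos_le_one)
  have "\<bar>f t\<bar> \<le> 2" for t
  proof -
    have "exp (- \<tau> * ((1 - cos t) / 2) powr \<beta>) \<le> 1"
      using \<tau> by simp
    moreover have "exp (- \<tau> * ((1 - cos t) / 2) powr \<beta>) > 0" by simp
    moreover have "\<epsilon> \<le> 1" using e4 exp_gt_zero[of "-1::real"] e by linarith
    ultimately show ?thesis using R(2)[OF Y, of t] unfolding f_def abs_le_iff by linarith
  qed
  \<comment> \<open>The degree bound \<open>Suc d\<close> keeps \<open>bernstein\<close> applicable
    when d = 0; the second 2 bounds |f|.\<close>
  define X where "X = 2 * real (Suc d) * 2 * (4 / g)"
  have "\<bar>f (4 / g) - f 0\<bar> \<le> X"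
    unfolding X_def using \<open>\<And>t. \<bar>f t\<bar> \<le> 2\<close> g R(1) by (intro bernstein) (auto simp: f_def intro: cos_poly_poly)
  moreover have "f 0 \<ge> 1 - \<epsilon>"
    using R(2)[of 0] by (simp add: f_def abs_le_iff)
  moreover have "f (4 / g) \<le> exp (- 1) + \<epsilon>"
  proof -
    define y where "y = (1 - cos (4 / g)) / 2"
    have "(1 / g)\<^sup>2 \<le> (sin (2 / g))\<^sup>2"
      using sin_ge_half[of "2 / g"] g by (intro power_mono) (auto simp: field_simps)
    also have "\<dots> = y" using cos_double_sin[of "2 / g"] by (simp add: y_def)
    finally have "((1 / g)\<^sup>2) powr \<beta> \<le> y powr \<beta>" using b by (intro powr_mono2) auto
    moreover have "((1 / g)\<^sup>2) powr \<beta> = 1 / \<tau>"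
    proof -
      have "(1 / g)\<^sup>2 = (1 / g) powr 2" using g by simp
      also have "\<dots> powr \<beta> = (1 / g) powr (2 * \<beta>)" by (simp add: powr_powr)
      also have "\<dots> = 1 / g powr (2 * \<beta>)" by (simp add: powr_divide)
      also have "g powr (2 * \<beta>) = \<tau>" using b \<tau> by (simp add: g_def powr_powr)
      finally show ?thesis .
    qed
    ultimately have "1 / \<tau> \<le> y powr \<beta>" by (simp only:)
    then have "\<tau> * y powr \<beta> \<ge> 1" using \<tau> by (simp add: field_simps)
    then have "exp (- \<tau> * y powr \<beta>) \<le> exp (- 1)" by simp
    moreover have "\<bar>poly R y - exp (- \<tau> * y powr \<beta>)\<bar> \<le> \<epsilon>" using R(2) Y unfolding y_def by blast
    ultimately have "poly R y \<le> exp (- 1) + \<epsilon>" by linarith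
    then show ?thesis by (simp add: f_def y_def)
  qed
  ultimately have "1 - exp (- 1) \<le> 2 * X"
    using e4 unfolding abs_le_iff by linarith
  then have "(1 - exp (- 1)) / 32 * g \<le> real d + 1"
    using g by (simp add: X_def field_simps)
  then show ?thesis unfolding g_def .
qed

section \<open>Integer exponents\<close>

text \<open>One term of the exponential series at n; it replaces Stirling's formula.\<close>

lemma power_le_fact_exp: "real n ^ n \<le> fact n * exp (real n)"
proof -
  have e: "(\<lambda>k. real n ^ k / fact k) sums exp (real n)"
    using exp_converges[of "real n"] by (simp add: divide_inverse mult.commute)
  have "(\<Sum>k\<in>{n}. real n ^ k / fact k) \<le> exp (real n)"
    unfolding sums_unique[OF e] by (intro sum_le_suminf sums_summable[OF e]) auto
  then show ?thesis by (simp add: field_simps)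
qed

text \<open>The Taylor remainder is at most exp \<tau> * \<tau> ^ K / fact K, and K! \<ge> (K /
  e)^K. The exponential form prepares the comparison with ln (1 / \<epsilon>).\<close>

lemma approximable_taylor:
  fixes m K :: nat
  assumes \<tau>: "\<tau> > 0" and m: "m > 0" and K: "K > 0"
  shows "approximable (real m) \<tau> (exp (\<tau> + real K * (1 + ln \<tau> - ln (real K)))) (m * K)"
proof -
  define P where "P = (\<Sum>k<K. monom ((- \<tau>) ^ k / fact k) (m * k))"
  have "degree P \<le> m * K"
    unfolding P_def by (intro degree_sum_le) (auto intro!: order_trans[OF degree_monom_le])
  moreover have "\<bar>poly P y - exp (- \<tau> * y powr real m)\<bar> \<le> exp (\<tau> + real K * (1 + ln \<tau> - ln (real K)))"
    if y: "y \<in> {0..1}" for y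
  proof -
    define z where "z = - \<tau> * y powr real m"
    have ym: "y powr real m = y ^ m" using y m by (cases "y = 0") (auto simp: powr_realpow)
    have z: "\<bar>z\<bar> \<le> \<tau>" using y \<tau> by (simp add: z_def ym abs_mult mult_le_one power_le_one)
    have "poly P y = (\<Sum>k<K. z ^ k / fact k)"
      by (simp add: P_def poly_sum poly_monom z_def ym power_mult power_mult_distrib mult.assoc power_minus[of \<tau>] power_minus[of "\<tau> * y ^ m"])
    moreover obtain t where t: "\<bar>t\<bar> \<le> \<bar>z\<bar>" "exp z = (\<Sum>k<K. z ^ k / fact k) + exp t / fact K * z ^ K"
      using Maclaurin_exp_le[of z K] by blast
    ultimately have "\<bar>poly P y - exp z\<bar> = exp t / fact K * \<bar>z\<bar> ^ K"
      by (simp add: abs_mult power_abs)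
    also have "\<dots> \<le> exp \<tau> / fact K * \<tau> ^ K"
      using t z by (intro mult_mono divide_right_mono power_mono) auto
    also have "\<dots> \<le> exp \<tau> * (exp (real K) * \<tau> ^ K / real K ^ K)"
      using power_le_fact_exp[of K] K \<tau> by (simp add: field_simps)
    also have "\<dots> = exp (\<tau> + real K * (1 + ln \<tau> - ln (real K)))"
      using \<tau> K by (simp add: exp_add exp_diff ring_distribs exp_of_nat_mult)
    finally show ?thesis by (simp add: z_def)
  qed
  ultimately show ?thesis unfolding approximable_def by blast
qed

text \<open>Taking a difference of step \<open>h\<close> multiplies the bound on the top derivative
  by \<open>h\<close>, by the mean value theorem, and at most doubles the supremum of the function:
  a factor h / 2 per order.\<close>

lemma difference_lower_bound:
  fixes G :: "nat \<Rightarrow> real \<Rightarrow> real"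
  assumes "\<And>i x. i < N \<Longrightarrow> (G i has_real_derivative G (Suc i) x) (at x)"
    and "\<And>x. x \<in> {a..a + real N * h} \<Longrightarrow> G N x \<ge> \<mu>" and h: "h > 0"
  shows "\<exists>x\<in>{a..a + real N * h}. \<bar>G 0 x\<bar> \<ge> \<mu> * (h / 2) ^ N"
  using assms(1,2)
proof (induction N arbitrary: G \<mu>)
  case 0
  then show ?case using abs_ge_self[of "G 0 a"] by (auto intro: order_trans)
next
  case (Suc N)
  define D where "D = (\<lambda>i x. G i (x + h) - G i x)"
  have "\<exists>x\<in>{a..a + real N * h}. \<bar>D 0 x\<bar> \<ge> (\<mu> * h) * (h / 2) ^ N"
  proof (rule Suc.IH)
    fix i x assume "i < N"
    then have d: "(G i has_real_derivative G (Suc i) z) (at z)" for z using Suc.prems(1) by simp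
    have "((\<lambda>x. G i (x + h)) has_real_derivative G (Suc i) (x + h)) (at x)"
      using DERIV_shift[of "G i" _ x h] d by blast
    then show "(D i has_real_derivative D (Suc i) x) (at x)"
      unfolding D_def using d by (intro DERIV_diff)
  next
    fix x assume x: "x \<in> {a..a + real N * h}"
    obtain z where z: "x < z" "z < x + h" "G N (x + h) - G N x = (x + h - x) * G (Suc N) z"
      using MVT2[of x "x + h" "G N" "G (Suc N)"] Suc.prems(1) h by auto
    have "G (Suc N) z \<ge> \<mu>"
      using z x by (intro Suc.prems(2)) (auto simp: algebra_simps)
    then show "\<mu> * h \<le> D N x" using z(3) h by (simp add: D_def mult.commute)
  qed
  then obtain x where x: "x \<in> {a..a + real N * h}" "\<bar>D 0 x\<bar> \<ge> (\<mu> * h) * (h / 2) ^ N" by blast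
  have e: "(\<mu> * h) * (h / 2) ^ N = 2 * (\<mu> * (h / 2) ^ Suc N)" by simp
  have "\<bar>G 0 (x + h)\<bar> \<ge> \<mu> * (h / 2) ^ Suc N \<or> \<bar>G 0 x\<bar> \<ge> \<mu> * (h / 2) ^ Suc N"
    using x(2) unfolding e D_def by linarith
  moreover have "x \<in> {a..a + real (Suc N) * h}" "x + h \<in> {a..a + real (Suc N) * h}"
    using x(1) h by (auto simp: algebra_simps)
  ultimately show ?case by blast
qed

lemma diffs_iterate: "(diffs ^^ N) c k = fact (k + N) / fact k * (c (k + N) :: real)"
proof (induction N arbitrary: k)
  case (Suc N)
  have "fact (Suc k + N) / fact (Suc k) * real (Suc k) = fact (k + Suc N) / (fact k :: real)"
    by (simp add: divide_simps)
  then show ?case using Suc[of "Suc k"] by (simp add: diffs_def mult_ac)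
qed simp

text \<open>Controls how N-fold differentiation inflates Taylor coefficients: (N + k)! / k! is at
  most N! (N + 1)^k. The step uses n + k + 1 \<le> (k + 1) (n + 1).\<close>

lemma binomial_add_le_power: "((n + k) choose k) \<le> (n + 1) ^ k"
proof (induction k)
  case (Suc k)
  have "Suc k * ((n + Suc k) choose Suc k) = (n + Suc k) * ((n + k) choose k)"
    using Suc_times_binomial_eq[of "n + k" k] by (simp add: mult.commute)
  also have "\<dots> \<le> (Suc k * (n + 1)) * (n + 1) ^ k"
    using Suc by (intro mult_mono) auto
  finally have "Suc k * ((n + Suc k) choose Suc k) \<le> Suc k * (n + 1) ^ Suc k"
    by (simp only: power_Suc mult.assoc)
  then show ?case by (simp only: mult_le_cancel1)
qed simp

text \<open>The function \<open>exp (- \<tau> y ^ m)\<close> minus a polynomial of degree below \<open>N = m i\<close> has an \<open>N\<close>-th derivative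
  whose constant term \<open>\<plusminus>\<tau> ^ i N! / i!\<close> dominates on an interval of length of order \<open>1 / N\<close>.\<close>

lemma approximable_exp_power_lower:
  fixes m i :: nat
  assumes \<tau>: "\<tau> > 0" and m: "m > 0" and i: "i > 0" and \<kappa>: "0 < \<kappa>" "\<kappa> \<le> 1" "\<kappa> \<le> 1 / (3 * \<tau>)"
    and N: "N = m * i" and d: "d < N" and adm: "approximable (real m) \<tau> \<epsilon> d"
  shows "\<epsilon> \<ge> 1 / 2 * \<tau> ^ i * (\<kappa> / (2 * real N * (real N + 1))) ^ N"
proof -
  obtain R :: "real poly" where R: "degree R \<le> d"
    "\<And>y. y \<in> {0..1} \<Longrightarrow> \<bar>poly R y - exp (- \<tau> * y powr real m)\<bar> \<le> \<epsilon>"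
    using adm unfolding approximable_def by blast
  have N0: "N > 0" using N m i by simp
  define a where "a = (\<lambda>k. if m dvd k then (- \<tau>) ^ (k div m) / fact (k div m) else 0)"
  have mono: "strict_mono (\<lambda>j. m * j)" using m by (auto simp: strict_mono_def)
  have dvd: "m dvd k \<longleftrightarrow> k \<in> range (\<lambda>j. m * j)" for k by auto
  have a_sums: "(\<lambda>k. a k * y ^ k) sums exp (- \<tau> * y ^ m)" for y :: real
  proof -
    have "(\<lambda>j. (- \<tau> * y ^ m) ^ j / fact j) sums exp (- \<tau> * y ^ m)"
      using exp_converges[of "- \<tau> * y ^ m"] by (simp add: divide_inverse mult.commute)
    also have "(\<lambda>j. (- \<tau> * y ^ m) ^ j / fact j) = (\<lambda>j. a (m * j) * y ^ (m * j))"
      using m by (simp add: a_def power_mult power_mult_distrib fun_eq_iff power_minus[of \<tau>] power_minus[of "\<tau> * y ^ m"])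
    finally show ?thesis
      by (subst (asm) sums_mono_reindex[OF mono, of "\<lambda>k. a k * y ^ k"]) (auto simp: a_def)
  qed
  \<comment> \<open>Makes the constant term of the N-th derivative positive; \<open>R\<close>
    contributes nothing to it, since d < N.\<close>
  define s where "s = (-1 :: real) ^ i"
  define b where "b = (\<lambda>k. s * (a k - coeff R k))"
  have R_sums: "(\<lambda>k. coeff R k * y ^ k) sums poly R y" for y
    unfolding poly_altdef by (rule sums_finite) (auto simp: coeff_eq_0)
  have b_sums: "(\<lambda>k. b k * y ^ k) sums (s * (exp (- \<tau> * y ^ m) - poly R y))" for y
    using sums_mult[OF sums_diff[OF a_sums R_sums], of s y] by (simp add: b_def algebra_simps)
  define G where "G = (\<lambda>j y. \<Sum>k. (diffs ^^ j) b k * y ^ k)"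
  have summ: "summable (\<lambda>k. (diffs ^^ j) b k * y ^ k)" for j y
  proof (induction j arbitrary: y)
    case 0
    then show ?case using sums_summable[OF b_sums] by simp
  next
    case (Suc j)
    then show ?case using termdiff_converges_all[of "(diffs ^^ j) b" y] by simp
  qed
  have deriv: "(G j has_real_derivative G (Suc j) x) (at x)" for j x
    unfolding G_def using termdiffs_strong_converges_everywhere[OF summ, of j x] by simp
  have G0: "G 0 y = s * (exp (- \<tau> * y ^ m) - poly R y)" for y
    using sums_unique[OF b_sums, of y] by (simp add: G_def)
  define \<mu> where "\<mu> = 1 / 2 * (\<tau> ^ i * fact N / fact i)"
  define h where "h = \<kappa> / (real N * (real N + 1))"
  have h: "h > 0" using N0 \<kappa> by (simp add: h_def)
  have Nh: "real N * h = \<kappa> / (real N + 1)" using N0 by (simp add: h_def)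
  have lower: "G N y \<ge> \<mu>" if y: "y \<in> {0..0 + real N * h}" for y
  proof -
    \<comment> \<open>The terms after the first add up to at most M (exp w - 1). On the interval (N
      + 1) y \<le> \<kappa> \<le> 1, so \<kappa> \<le> 1 / (3 \<tau>) gives w \<le> 1 / 3 and exp w
      \<le> 3 / 2: half of \<open>M\<close> survives, which is \<mu>.\<close>
    define w where "w = \<tau> * ((real N + 1) * y) ^ m"
    have "(real N + 1) * y \<le> \<kappa>" using y unfolding Nh by (simp add: field_simps)
    then have "((real N + 1) * y) ^ m \<le> \<kappa> ^ m" using y by (intro power_mono) auto
    also have "\<kappa> ^ m \<le> \<kappa> ^ 1" using m \<kappa> by (intro power_decreasing) auto
    finally have "w \<le> \<tau> * \<kappa>" using \<tau> by (simp add: w_def)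
    also have "\<dots> \<le> 1 / 3" using \<tau> \<kappa> by (simp add: field_simps)
    finally have w: "w \<le> 1 / 3" .
    have w0: "w \<ge> 0" using \<tau> y by (simp add: w_def)
    have expw: "exp w \<le> 3 / 2"
    proof -
      have "exp w \<le> 1 + w + w\<^sup>2" using w w0 by (intro exp_bound) auto
      also have "w\<^sup>2 \<le> (1 / 3)\<^sup>2" using w w0 by (intro power_mono) auto
      finally show ?thesis using w by (simp add: power2_eq_square)
    qed
    define v where "v = (\<lambda>j. (diffs ^^ N) b (m * j) * y ^ (m * j))"
    define M where "M = \<tau> ^ i * fact N / fact i"
    have M0: "M \<ge> 0" using \<tau> by (simp add: M_def)
    have veq: "(diffs ^^ N) b k = s * (fact (k + N) / fact k * a (k + N))" for k
      using R(1) d by (simp add: diffs_iterate b_def coeff_eq_0)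
    have "v sums G N y"
    proof -
      have "(\<lambda>k. (diffs ^^ N) b k * y ^ k) sums G N y" using summ unfolding G_def by (rule summable_sums)
      moreover have "(diffs ^^ N) b k * y ^ k = 0" if "k \<notin> range (\<lambda>j. m * j)" for k
      proof -
        have "a (k + N) = 0" using that dvd[of k] by (simp add: a_def N dvd_add_left_iff)
        then show ?thesis by (simp add: veq)
      qed
      ultimately show ?thesis
        unfolding v_def using sums_mono_reindex[OF mono, of "\<lambda>k. (diffs ^^ N) b k * y ^ k"] by simp
    qed
    then have v_tail: "(\<lambda>j. v (Suc j)) sums (G N y - v 0)"
      by (subst sums_Suc_iff) simp
    have v0: "v 0 = M"
    proof -
      have "a N = (- \<tau>) ^ i / fact i" using m by (simp add: a_def N)
      moreover have "s * (- \<tau>) ^ i = \<tau> ^ i" by (simp add: s_def flip: power_mult_distrib)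
      ultimately show ?thesis by (simp add: v_def veq M_def)
    qed
    \<comment> \<open>The binomial bound supplies (N + 1)^(m j), and j! i! \<le> (j + i)! splits off
      the factorial of \<open>M\<close>; what remains is the exponential series of
      \<open>w\<close>.\<close>
    have vle: "\<bar>v j\<bar> \<le> M * (w ^ j / fact j)" for j
    proof -
      have "a (m * j + N) = (- \<tau>) ^ (j + i) / fact (j + i)"
        using m by (simp add: a_def N flip: distrib_left)
      then have "\<bar>v j\<bar> = \<tau> ^ (j + i) / fact (j + i) * (fact (m * j + N) / fact (m * j)) * y ^ (m * j)"
        using \<tau> y by (simp add: v_def veq s_def abs_mult power_abs)
      also have "fact (m * j + N) / fact (m * j) = (fact N :: real) * real ((N + m * j) choose (m * j))"
        by (simp add: binomial_fact add.commute)
      also have "\<tau> ^ (j + i) / fact (j + i) * (fact N * real ((N + m * j) choose (m * j))) * y ^ (m * j)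
          \<le> \<tau> ^ (j + i) / (fact j * fact i) * (fact N * (real N + 1) ^ (m * j)) * y ^ (m * j)"
      proof (intro mult_mono divide_left_mono mult_nonneg_nonneg)
        have "real ((N + m * j) choose (m * j)) \<le> real ((N + 1) ^ (m * j))"
          unfolding of_nat_le_iff by (rule binomial_add_le_power)
        then show "real ((N + m * j) choose (m * j)) \<le> (real N + 1) ^ (m * j)" by (simp add: add.commute)
        have "fact j * fact i \<le> (fact (j + i) :: nat)"
          using fact_fact_dvd_fact[of j i] by (intro dvd_imp_le) auto
        then show "fact j * fact i \<le> (fact (j + i) :: real)"
          by (metis of_nat_fact of_nat_le_iff of_nat_mult)
      qed (use \<tau> y in auto)
      also have "\<dots> = M * (w ^ j / fact j)"
      proof -
        have "w ^ j = \<tau> ^ j * ((real N + 1) ^ (m * j) * y ^ (m * j))"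
          by (simp add: w_def power_mult power_mult_distrib)
        then show ?thesis by (simp add: M_def power_add mult_ac)
      qed
      finally show ?thesis .
    qed
    have e: "(\<lambda>j. M * (w ^ j / fact j)) sums (M * exp w)"
      using sums_mult[OF exp_converges[of w], of M] by (simp add: divide_inverse mult.commute)
    have w_tail: "(\<lambda>j. M * (w ^ Suc j / fact (Suc j))) sums (M * exp w - M)"
      using e by (subst sums_Suc_iff) simp
    have "norm (\<Sum>j. v (Suc j)) \<le> (\<Sum>j. M * (w ^ Suc j / fact (Suc j)))"
      using vle by (intro norm_suminf_le sums_summable[OF w_tail]) (simp only: real_norm_def)
    then have "norm (G N y - v 0) \<le> M * exp w - M"
      by (simp only: sums_unique[OF v_tail] sums_unique[OF w_tail])
    then have "G N y \<ge> M - (M * exp w - M)" unfolding v0 by (simp add: abs_le_iff)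
    also have "M - (M * exp w - M) \<ge> M - M * (1 / 2)"
      using mult_left_mono[OF expw M0] by (simp add: algebra_simps)
    finally show ?thesis by (simp add: \<mu>_def M_def mult.commute)
  qed
  obtain x where x: "x \<in> {0..0 + real N * h}" "\<bar>G 0 x\<bar> \<ge> \<mu> * (h / 2) ^ N"
    using difference_lower_bound[of N G 0 h \<mu>] deriv lower h by blast
  have x1: "x \<in> {0..1}" 
  proof -
    have "\<kappa> / (real N + 1) \<le> 1" using \<kappa> by (simp add: field_simps)
    moreover have "0 \<le> x" "x \<le> \<kappa> / (real N + 1)" using x(1) Nh by auto
    ultimately show ?thesis using order_trans[of x "\<kappa> / (real N + 1)" 1] by simp
  qed
  have "x powr real m = x ^ m"
    using x1 m by (cases "x = 0") (auto simp: powr_realpow)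
  then have "\<bar>G 0 x\<bar> = \<bar>poly R x - exp (- \<tau> * x powr real m)\<bar>"
    by (simp add: G0 s_def abs_mult power_abs abs_minus_commute)
  then have "\<mu> * (h / 2) ^ N \<le> \<epsilon>" using x(2) R(2)[OF x1] by simp
  moreover have "1 / 2 * \<tau> ^ i * (h / 2) ^ N \<le> \<mu> * (h / 2) ^ N"
  proof (intro mult_right_mono)
    have "i \<le> N" using m by (simp add: N)
    then have "fact i \<le> (fact N :: real)" by (rule fact_mono)
    then have "1 \<le> fact N / (fact i :: real)" by simp
    then have "\<tau> ^ i * 1 \<le> \<tau> ^ i * (fact N / fact i)" using \<tau> by (intro mult_left_mono) auto
    then show "1 / 2 * \<tau> ^ i \<le> \<mu>" by (simp add: \<mu>_def)
  qed (use h in auto)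
  ultimately have "1 / 2 * \<tau> ^ i * (h / 2) ^ N \<le> \<epsilon>" by (rule order_trans[rotated])
  moreover have "h / 2 = \<kappa> / (2 * real N * (real N + 1))" by (simp add: h_def mult.assoc)
  ultimately show ?thesis by (simp only:)
qed

section \<open>Rates as the error tends to 0\<close>

lemma approximable_mono:
  "approximable \<beta> \<tau> \<epsilon> d \<Longrightarrow> \<epsilon> \<le> \<epsilon>' \<Longrightarrow> d \<le> d' \<Longrightarrow> approximable \<beta> \<tau> \<epsilon>' d'"
  unfolding approximable_def by (meson order_trans)

text \<open>Solving C (n + 1)^(-2 \<beta>) \<le> \<epsilon> for n, in the case k0 = 1 of
  \<open>exp_powr_tail_approx\<close>; the removed term 1 is added back to the polynomial.\<close>

lemma approximable_nonint_upper:
  assumes b: "\<beta> > 0" and \<tau>: "\<tau> > 0"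
  obtains C where "\<forall>\<^sub>F \<epsilon> in at_right 0. \<exists>d. approximable \<beta> \<tau> \<epsilon> d \<and> real d \<le> C * \<epsilon> powr (- 1 / (2 * \<beta>))"
proof -
  obtain C where C: "C > 0" and P: "\<And>n. \<exists>P :: real poly. degree P \<le> n \<and> (\<forall>y\<in>{0..1}.
      \<bar>poly P y - (exp (- \<tau> * y powr \<beta>) - (\<Sum>k<1. (- \<tau> * y powr \<beta>) ^ k / fact k))\<bar>
        \<le> C * (real n + 1) powr (- (2 * real 1 * \<beta>)))"
    using exp_powr_tail_approx[OF b zero_less_one, of "- \<tau>"] by metis
  have adm: "approximable \<beta> \<tau> (C * (real n + 1) powr (- (2 * \<beta>))) n" for n
  proof -
    obtain P where P': "degree P \<le> n" "\<And>y. y \<in> {0..1} \<Longrightarrow> \<bar>poly P y - (exp (- \<tau> * y powr \<beta>) - 1)\<bar>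
        \<le> C * (real n + 1) powr (- (2 * \<beta>))"
      using P[of n] by auto
    have "degree (P + 1) \<le> n" using P'(1) by (intro degree_add_le) auto
    then show ?thesis
      unfolding approximable_def using P'(2) by (intro exI[of _ "P + 1"]) (auto simp: algebra_simps)
  qed
  define q where "q = 1 / (2 * \<beta>)"
  have q: "q > 0" using b by (simp add: q_def)
  have "\<forall>\<^sub>F \<epsilon> in at_right 0. \<exists>d. approximable \<beta> \<tau> \<epsilon> d \<and> real d \<le> (C powr q + 1) * \<epsilon> powr (- 1 / (2 * \<beta>))"
  proof -
    have "\<forall>\<^sub>F \<epsilon>::real in at_right 0. \<epsilon> \<in> {0<..<1}" by (rule eventually_at_right_real) simp
    then show ?thesis
    proof eventually_elim
      case (elim \<epsilon>)
      then have e: "0 < \<epsilon>" "\<epsilon> < 1" by auto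
      define n where "n = nat \<lceil>(C / \<epsilon>) powr q\<rceil>"
      have g: "\<epsilon> powr (- 1 / (2 * \<beta>)) = \<epsilon> powr (- q)" by (simp add: q_def)
      have Ce: "(C / \<epsilon>) powr q = C powr q * \<epsilon> powr (- q)"
        by (simp add: powr_divide powr_minus_divide)
      have "(C / \<epsilon>) powr q \<le> real n + 1" unfolding n_def by linarith
      then have "(real n + 1) powr (- (2 * \<beta>)) \<le> ((C / \<epsilon>) powr q) powr (- (2 * \<beta>))"
        using b C e by (intro powr_mono2') auto
      also have "\<dots> = (C / \<epsilon>) powr (- 1)" using b by (simp add: powr_powr q_def)
      also have "\<dots> = \<epsilon> / C" using C e by (simp add: powr_minus_divide)
      finally have "C * (real n + 1) powr (- (2 * \<beta>)) \<le> \<epsilon>" using C by (simp add: field_simps)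
      then have "approximable \<beta> \<tau> \<epsilon> n" using approximable_mono[OF adm[of n]] by blast
      moreover have "real n \<le> (C powr q + 1) * \<epsilon> powr (- q)"
      proof -
        have "(C / \<epsilon>) powr q \<ge> 0" by simp
        then have "real n \<le> (C / \<epsilon>) powr q + 1" unfolding n_def by linarith
        moreover have "\<epsilon> powr (- q) \<ge> \<epsilon> powr 0" using e q by (intro powr_mono') auto
        then have "\<epsilon> powr (- q) \<ge> 1" using e by simp
        ultimately show ?thesis unfolding Ce by (simp add: algebra_simps)
      qed
      ultimately show ?case unfolding g by blast
    qed
  qed
  then show ?thesis using that by blast
qed

text \<open>If \<open>R\<close> approximates the exponential and \<open>Q\<close> its tail from k =
  2 on, then (1 + Q - R) / \<tau> approximates y^\<beta>. The tail costs only n^(-4 \<beta>), at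
  most half of the unavoidable n^(-2 \<beta>) for large n.\<close>

lemma approximable_nonint_lower:
  assumes b: "\<beta> > 0" and nat: "\<forall>j. \<beta> \<noteq> real j" and \<tau>: "\<tau> > 0"
  obtains c where "c > 0"
    "\<forall>\<^sub>F \<epsilon> in at_right 0. \<forall>d. approximable \<beta> \<tau> \<epsilon> d \<longrightarrow> c * \<epsilon> powr (- 1 / (2 * \<beta>)) \<le> real d + 1"
proof -
  obtain C where C: "C > 0" and P: "\<And>n. \<exists>P :: real poly. degree P \<le> n \<and> (\<forall>y\<in>{0..1}.
      \<bar>poly P y - (exp (- \<tau> * y powr \<beta>) - (\<Sum>k<2. (- \<tau> * y powr \<beta>) ^ k / fact k))\<bar>
        \<le> C * (real n + 1) powr (- (2 * real 2 * \<beta>)))"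
    by (rule exp_powr_tail_approx[OF b pos2, of "- \<tau>"]) blast
  obtain c N where c: "c > 0" and lower: "\<And>n P e. n \<ge> N \<Longrightarrow> degree P \<le> n \<Longrightarrow>
      (\<And>y. y \<in> {0..1} \<Longrightarrow> \<bar>poly P y - y powr \<beta>\<bar> \<le> e) \<Longrightarrow> e \<ge> c * real n powr (- (2 * \<beta>))"
    by (rule powr_approx_error_ge[OF b nat]) blast
  have one: "\<epsilon> + C * (real n + 1) powr (- (4 * \<beta>)) \<ge> c * \<tau> * real n powr (- (2 * \<beta>))"
    if n: "n \<ge> N" and adm: "approximable \<beta> \<tau> \<epsilon> n" for n \<epsilon>
  proof -
    obtain R where R: "degree R \<le> n" "\<And>y. y \<in> {0..1} \<Longrightarrow> \<bar>poly R y - exp (- \<tau> * y powr \<beta>)\<bar> \<le> \<epsilon>"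
      using adm unfolding approximable_def by blast
    obtain Q where Q: "degree Q \<le> n" "\<And>y. y \<in> {0..1} \<Longrightarrow>
        \<bar>poly Q y - (exp (- \<tau> * y powr \<beta>) - (1 - \<tau> * y powr \<beta>))\<bar> \<le> C * (real n + 1) powr (- (4 * \<beta>))"
      using P[of n] by (auto simp: numeral_2_eq_2)
    define S where "S = smult (1 / \<tau>) (1 + Q - R)"
    have "degree S \<le> n"
      unfolding S_def using R(1) Q(1)
      by (intro order_trans[OF degree_smult_le] degree_diff_le degree_add_le) auto
    moreover have "\<bar>poly S y - y powr \<beta>\<bar> \<le> (\<epsilon> + C * (real n + 1) powr (- (4 * \<beta>))) / \<tau>" if y: "y \<in> {0..1}" for y
    proof -
      have "poly S y - y powr \<beta> = ((poly Q y - (exp (- \<tau> * y powr \<beta>) - (1 - \<tau> * y powr \<beta>)))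
          - (poly R y - exp (- \<tau> * y powr \<beta>))) / \<tau>"
        using \<tau> by (simp add: S_def field_simps)
      also have "\<bar>\<dots>\<bar> \<le> (C * (real n + 1) powr (- (4 * \<beta>)) + \<epsilon>) / \<tau>"
        unfolding abs_divide using \<tau> Q(2)[OF y] R(2)[OF y]
        by (auto intro!: divide_right_mono order_trans[OF abs_triangle_ineq4] add_mono)
      finally show ?thesis by (simp add: add.commute)
    qed
    ultimately have "(\<epsilon> + C * (real n + 1) powr (- (4 * \<beta>))) / \<tau> \<ge> c * real n powr (- (2 * \<beta>))"
      by (rule lower[OF n])
    then show ?thesis using \<tau> by (simp add: field_simps)
  qed
  have "\<forall>\<^sub>F x::real in at_top. C * (x + 1) powr (- (4 * \<beta>)) \<le> c * \<tau> / 2 * x powr (- (2 * \<beta>))"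
    using b c \<tau> C by real_asymp
  then have "\<forall>\<^sub>F n in sequentially. C * (real n + 1) powr (- (4 * \<beta>)) \<le> c * \<tau> / 2 * real n powr (- (2 * \<beta>))"
    by (rule eventually_compose_filterlim[OF _ filterlim_real_sequentially])
  then obtain N' where N': "\<And>n. n \<ge> N' \<Longrightarrow> C * (real n + 1) powr (- (4 * \<beta>)) \<le> c * \<tau> / 2 * real n powr (- (2 * \<beta>))"
    unfolding eventually_sequentially by blast
  define M where "M = max 1 (max N N')"
  define q where "q = 1 / (2 * \<beta>)"
  have q: "q > 0" using b by (simp add: q_def)
  define c' where "c' = (c * \<tau> / 2) powr q"
  have c': "c' > 0" using c \<tau> by (simp add: c'_def)
  have two: "c' * \<epsilon> powr (- q) \<le> real n" if n: "n \<ge> M" and adm: "approximable \<beta> \<tau> \<epsilon> n" and e: "\<epsilon> > 0" for n \<epsilon>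
  proof -
    have n1: "n \<ge> N" "n \<ge> N'" "n > 0" using n by (auto simp: M_def)
    have "\<epsilon> \<ge> c * \<tau> / 2 * real n powr (- (2 * \<beta>))"
      using one[OF n1(1) adm] N'[OF n1(2)] by (simp add: field_simps)
    then have "real n powr (2 * \<beta>) \<ge> c * \<tau> / 2 / \<epsilon>"
      using e n1 by (simp add: powr_minus field_simps)
    then have "(c * \<tau> / 2 / \<epsilon>) powr q \<le> (real n powr (2 * \<beta>)) powr q"
      using q c \<tau> e by (intro powr_mono2) auto
    also have "\<dots> = real n" using b n1 by (simp add: powr_powr q_def)
    also have "(c * \<tau> / 2 / \<epsilon>) powr q = c' * \<epsilon> powr (- q)"
      by (simp add: c'_def powr_divide powr_minus_divide del: divide_divide_eq_left)
    finally show ?thesis .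
  qed
  have "\<forall>\<^sub>F \<epsilon> in at_right 0. c' * \<epsilon> powr (- q) > real M"
    using q c' by real_asymp
  then have "\<forall>\<^sub>F \<epsilon> in at_right 0. \<forall>d. approximable \<beta> \<tau> \<epsilon> d \<longrightarrow> c' * \<epsilon> powr (- 1 / (2 * \<beta>)) \<le> real d + 1"
    using eventually_at_right_less
  proof eventually_elim
    case (elim \<epsilon>)
    show ?case
    proof (intro allI impI)
      fix d assume "approximable \<beta> \<tau> \<epsilon> d"
      \<comment> \<open>The estimate needs degrees from \<open>M\<close> on. Raising
        \<open>d\<close> to \<open>M\<close> loses nothing, because for small \<epsilon> the bound
        exceeds \<open>M\<close> and the maximum must be \<open>d\<close>.\<close>
      then have "approximable \<beta> \<tau> \<epsilon> (max d M)" by (rule approximable_mono) auto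
      then have "c' * \<epsilon> powr (- q) \<le> real (max d M)" using elim by (intro two) auto
      then have "c' * \<epsilon> powr (- q) \<le> real d" using elim by (auto simp: max_def split: if_splits)
      then show "c' * \<epsilon> powr (- 1 / (2 * \<beta>)) \<le> real d + 1" by (simp add: q_def)
    qed
  qed
  with c' show ?thesis using that by blast
qed

lemma approximable_int_upper:
  fixes m :: nat
  assumes m: "m > 0" and \<tau>: "\<tau> > 0"
  shows "\<forall>\<^sub>F \<epsilon> in at_right 0. \<exists>d. approximable (real m) \<tau> \<epsilon> d \<and>
    real d \<le> 8 * real m * (ln (1 / \<epsilon>) / ln (ln (1 / \<epsilon>)))"
proof -
  \<comment> \<open>For this x the product x ln x is asymptotically 4 L, with room beyond L for
    \<tau> and the linear terms. Rounding up costs at most a factor 2, whence the 8 in the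
    claim.\<close>
  let ?x = "\<lambda>L::real. 4 * L / ln L"
  have "\<forall>\<^sub>F L in at_top. ?x L \<ge> 1" "\<forall>\<^sub>F L in at_top. 1 + ln \<tau> - ln (?x L) \<le> 0"
    "\<forall>\<^sub>F L in at_top. \<tau> + ?x L * (1 + ln \<tau> - ln (?x L)) \<le> - L"
    by real_asymp+
  then have "\<forall>\<^sub>F L in at_top. ?x L \<ge> 1 \<and> 1 + ln \<tau> - ln (?x L) \<le> 0 \<and> \<tau> + ?x L * (1 + ln \<tau> - ln (?x L)) \<le> - L"
    by eventually_elim blast
  moreover have "filterlim (\<lambda>\<epsilon>::real. ln (1 / \<epsilon>)) at_top (at_right 0)" by real_asymp
  ultimately have "\<forall>\<^sub>F \<epsilon> in at_right 0. ?x (ln (1 / \<epsilon>)) \<ge> 1 \<and> 1 + ln \<tau> - ln (?x (ln (1 / \<epsilon>))) \<le> 0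
      \<and> \<tau> + ?x (ln (1 / \<epsilon>)) * (1 + ln \<tau> - ln (?x (ln (1 / \<epsilon>)))) \<le> - ln (1 / \<epsilon>)"
    by (rule eventually_compose_filterlim)
  then show ?thesis
    using eventually_at_right_less
  proof eventually_elim
    case (elim \<epsilon>)
    define L x where "L = ln (1 / \<epsilon>)" and "x = ?x (ln (1 / \<epsilon>))"
    have x: "x \<ge> 1" "1 + ln \<tau> - ln x \<le> 0" "\<tau> + x * (1 + ln \<tau> - ln x) \<le> - L" and e: "\<epsilon> > 0"
      using elim by (simp_all add: x_def L_def)
    define K where "K = nat \<lceil>x\<rceil>"
    have K: "x \<le> real K" "real K \<le> x + 1" using x unfolding K_def by linarith+
    then have K0: "K > 0" using x by (cases K) auto
    have "real K * (1 + ln \<tau> - ln (real K)) \<le> real K * (1 + ln \<tau> - ln x)"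
      using K x by (intro mult_left_mono) auto
    also have "\<dots> \<le> x * (1 + ln \<tau> - ln x)"
      using K x by (intro mult_right_mono_neg) auto
    finally have "exp (\<tau> + real K * (1 + ln \<tau> - ln (real K))) \<le> exp (- L)"
      using x(3) by simp
    also have "\<dots> = \<epsilon>" using e by (simp add: L_def ln_div)
    finally have "approximable (real m) \<tau> \<epsilon> (m * K)"
      using approximable_mono[OF approximable_taylor[OF \<tau> m K0]] by blast
    moreover have "real (m * K) \<le> 8 * real m * (ln (1 / \<epsilon>) / ln (ln (1 / \<epsilon>)))"
    proof -
      have "real (m * K) \<le> real m * (2 * x)" using K x by (simp add: mult_left_mono)
      also have "\<dots> = 8 * real m * (ln (1 / \<epsilon>) / ln (ln (1 / \<epsilon>)))" by (simp add: x_def)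
      finally show ?thesis .
    qed
    ultimately show ?case by blast
  qed
qed

lemma approximable_int_lower:
  fixes m :: nat
  assumes m: "m > 0" and \<tau>: "\<tau> > 0"
  shows "\<forall>\<^sub>F \<epsilon> in at_right 0. \<forall>d. approximable (real m) \<tau> \<epsilon> d \<longrightarrow>
    1 / (4 * real m) * (ln (1 / \<epsilon>) / ln (ln (1 / \<epsilon>))) \<le> real d + 1"
proof -
  define \<kappa> where "\<kappa> = min 1 (1 / (3 * \<tau>))"
  have \<kappa>: "0 < \<kappa>" "\<kappa> \<le> 1" "\<kappa> \<le> 1 / (3 * \<tau>)" using \<tau> by (auto simp: \<kappa>_def)
  \<comment> \<open>Collects the per-order constants of the logarithm of the lower bound: one ln 2
    for the prefactor 1 / 2, one for the halved step.\<close>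
  define B where "B = 2 * ln 2 + \<bar>ln \<tau>\<bar> + \<bar>ln \<kappa>\<bar>"
  have B: "B \<ge> 0" by (simp add: B_def)
  \<comment> \<open>Here 2 x ln (x + 1) is about L / 2, hence below L even with B x added; an order
    \<open>N\<close> below x would contradict the lower bound.\<close>
  let ?x = "\<lambda>L::real. L / (4 * ln L)"
  have "\<forall>\<^sub>F L in at_top. ?x L > 0" "\<forall>\<^sub>F L in at_top. ?x L * (B + 2 * ln (?x L + 1)) < L"
    by real_asymp+
  then have "\<forall>\<^sub>F L in at_top. ?x L > 0 \<and> ?x L * (B + 2 * ln (?x L + 1)) < L"
    by eventually_elim blast
  moreover have "filterlim (\<lambda>\<epsilon>::real. ln (1 / \<epsilon>)) at_top (at_right 0)" by real_asymp
  ultimately have "\<forall>\<^sub>F \<epsilon> in at_right 0. ?x (ln (1 / \<epsilon>)) > 0 \<and>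
      ?x (ln (1 / \<epsilon>)) * (B + 2 * ln (?x (ln (1 / \<epsilon>)) + 1)) < ln (1 / \<epsilon>)"
    by (rule eventually_compose_filterlim)
  then show ?thesis
    using eventually_at_right_less
  proof eventually_elim
    case (elim \<epsilon>)
    define L x where "L = ln (1 / \<epsilon>)" and "x = ?x (ln (1 / \<epsilon>))"
    have x: "x > 0" "x * (B + 2 * ln (x + 1)) < L" and e: "\<epsilon> > 0"
      using elim by (simp_all add: x_def L_def)
    show ?case
    proof (intro allI impI)
      fix d assume adm: "approximable (real m) \<tau> \<epsilon> d"
      \<comment> \<open>Makes \<open>N\<close> the least multiple of \<open>m\<close> above
        \<open>d\<close>.\<close>
      define i where "i = d div m + 1"
      define N where "N = m * i"
      have dN: "d < N" using m by (simp add: N_def i_def dividend_less_times_div)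
      have N0: "N > 0" using dN by simp
      have iN: "i \<le> N" using m by (simp add: N_def)
      have "\<epsilon> \<ge> 1 / 2 * \<tau> ^ i * (\<kappa> / (2 * real N * (real N + 1))) ^ N"
        using approximable_exp_power_lower[OF \<tau> m _ \<kappa> N_def dN adm] by (simp add: i_def)
      moreover have pos: "1 / 2 * \<tau> ^ i * (\<kappa> / (2 * real N * (real N + 1))) ^ N > 0"
        using \<tau> \<kappa> N0 by simp
      ultimately have "ln (1 / 2 * \<tau> ^ i * (\<kappa> / (2 * real N * (real N + 1))) ^ N) \<le> ln \<epsilon>"
        using e by (subst ln_le_cancel_iff) auto
      also have "ln (1 / 2 * \<tau> ^ i * (\<kappa> / (2 * real N * (real N + 1))) ^ N)
          = - ln 2 + real i * ln \<tau> + real N * (ln \<kappa> - ln 2 - ln (real N) - ln (real N + 1))"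
      proof -
        have "ln (\<kappa> / (2 * real N * (real N + 1))) = ln \<kappa> - ln (2 * real N * (real N + 1))"
          by (subst ln_div) (use \<kappa> N0 in auto)
        also have "ln (2 * real N * (real N + 1)) = ln (2 * real N) + ln (real N + 1)"
          by (subst ln_mult) (use N0 in auto)
        also have "ln (2 * real N) = ln 2 + ln (real N)"
          by (subst ln_mult) (use N0 in auto)
        finally have 1: "ln (\<kappa> / (2 * real N * (real N + 1))) = ln \<kappa> - ln 2 - ln (real N) - ln (real N + 1)"
          by simp
        have "\<kappa> / (2 * real N * (real N + 1)) > 0" using \<kappa> N0 by simp
        then have "ln (1 / 2 * \<tau> ^ i * (\<kappa> / (2 * real N * (real N + 1))) ^ N)
            = ln (1 / 2 * \<tau> ^ i) + ln ((\<kappa> / (2 * real N * (real N + 1))) ^ N)"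
          by (subst ln_mult) (use \<tau> in auto)
        also have "ln (1 / 2 * \<tau> ^ i) = ln (1 / 2) + ln (\<tau> ^ i)"
          by (subst ln_mult) (use \<tau> in auto)
        finally show ?thesis using \<tau> \<open>\<kappa> / (2 * real N * (real N + 1)) > 0\<close>
          by (simp only: ln_realpow 1) (simp add: ln_div)
      qed
      also have "ln \<epsilon> = - L" using e by (simp add: L_def ln_div)
      finally have L: "L \<le> ln 2 + real i * (- ln \<tau>) + real N * (- ln \<kappa> + ln 2 + ln (real N) + ln (real N + 1))"
        by (simp add: algebra_simps)
      have t1: "ln 2 \<le> real N * ln 2" using N0 by simp
      have t2: "real i * (- ln \<tau>) \<le> real N * \<bar>ln \<tau>\<bar>"
        using iN by (intro order_trans[OF mult_left_mono[OF abs_ge_minus_self] mult_right_mono]) auto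
      have t3: "real N * (- ln \<kappa> + ln 2 + ln (real N) + ln (real N + 1))
          \<le> real N * (\<bar>ln \<kappa>\<bar> + ln 2 + ln (real N + 1) + ln (real N + 1))"
        using N0 by (intro mult_left_mono add_mono) auto
      have L: "L \<le> real N * (B + 2 * ln (real N + 1))"
        using order_trans[OF L add_mono[OF add_mono[OF t1 t2] t3]] by (simp add: B_def algebra_simps)
      have "x \<le> real N"
      proof (rule ccontr)
        assume "\<not> x \<le> real N"
        then have "real N * (B + 2 * ln (real N + 1)) \<le> x * (B + 2 * ln (x + 1))"
          using N0 B by (intro mult_mono add_mono) auto
        then show False using L x by linarith
      qed
      also have "real N \<le> real m * (real d + 1)"
      proof -
        have "i \<le> d + 1" by (simp add: i_def)
        then have "N \<le> m * (d + 1)" unfolding N_def by (intro mult_le_mono2)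
        then have "real N \<le> real (m * (d + 1))" by (simp only: of_nat_le_iff)
        then show ?thesis by (simp add: algebra_simps)
      qed
      finally have "x / real m \<le> real d + 1" using m by (simp add: pos_divide_le_eq mult.commute)
      then show "1 / (4 * real m) * (ln (1 / \<epsilon>) / ln (ln (1 / \<epsilon>))) \<le> real d + 1"
        by (simp add: x_def mult_ac)
    qed
  qed
qed

section \<open>Minimal degrees\<close>

text \<open>The upper bound also provides a witness, so the minimum is attained and inherits the
  lower bound. Once c g \<ge> 2, the 1 is at most half of c g, which leaves the constant c /
  2.\<close>

lemma bigtheta_LEAST:
  fixes A :: "'a \<Rightarrow> nat \<Rightarrow> bool" and g :: "'a \<Rightarrow> real"
  assumes upper: "\<forall>\<^sub>F x in F. \<exists>d. A x d \<and> real d \<le> C * g x"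
    and lower: "\<forall>\<^sub>F x in F. \<forall>d. A x d \<longrightarrow> c * g x \<le> real d + 1"
    and c: "c > 0" and g: "filterlim g at_top F"
  shows "(\<lambda>x. real (LEAST d. A x d)) \<in> \<Theta>[F](g)"
proof (rule bigthetaI)
  have pos: "\<forall>\<^sub>F x in F. g x \<ge> max 0 (2 / c)"
    using g unfolding filterlim_at_top by blast
  show "(\<lambda>x. real (LEAST d. A x d)) \<in> O[F](g)"
  proof (rule bigoI)
    show "\<forall>\<^sub>F x in F. norm (real (LEAST d. A x d)) \<le> C * norm (g x)"
      using upper pos
    proof eventually_elim
      case (elim x)
      then obtain d where d: "A x d" "real d \<le> C * g x" by blast
      have "(LEAST d. A x d) \<le> d" using d(1) by (rule Least_le)
      then show ?case using d(2) elim(2) by simp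
    qed
  qed
  show "(\<lambda>x. real (LEAST d. A x d)) \<in> \<Omega>[F](g)"
  proof (rule landau_omega.bigI)
    show "c / 2 > 0" using c by simp
    show "\<forall>\<^sub>F x in F. norm (real (LEAST d. A x d)) \<ge> c / 2 * norm (g x)"
      using upper lower pos
    proof eventually_elim
      case (elim x)
      then have "A x (LEAST d. A x d)" by (blast intro: LeastI)
      then have "c * g x \<le> real (LEAST d. A x d) + 1" using elim(2) by blast
      moreover have "c * g x \<ge> 2" using elim(3) c by (simp add: field_simps)
      ultimately show ?case using elim(3) by simp
    qed
  qed
qed

section \<open>Both signals reduced to approximation on [0, 1]\<close>

lemma even_poly_obtain_square:
  fixes P :: "real poly"
  assumes even: "\<And>x. poly P (- x) = poly P x" and deg: "degree P \<le> d"
  obtains R where "degree R \<le> d div 2" "\<And>x. poly P x = poly R (x\<^sup>2)"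
proof -
  have "pcompose P [:0, -1:] = P"
    by (rule poly_ext) (simp add: poly_pcompose even)
  then have "(-1) ^ i * coeff P i = coeff P i" for i
    by (metis coeff_pcompose_linear)
  from this[of "Suc (2 * k)" for k] have odd: "coeff P (Suc (2 * k)) = 0" for k
    by simp
  define R where "R = (\<Sum>k\<le>d div 2. monom (coeff P (2 * k)) k)"
  have "degree R \<le> d div 2"
    unfolding R_def by (intro degree_sum_le) (auto intro: order_trans[OF degree_monom_le])
  moreover have "poly P x = poly R (x\<^sup>2)" for x
  proof -
    have split: "(\<Sum>i\<le>Suc (2 * n). f i) = (\<Sum>k\<le>n. f (2 * k) + f (Suc (2 * k)))" for f :: "nat \<Rightarrow> real" and n
      by (induction n) auto
    \<comment> \<open>Rounding the range up to an odd number lets the sum split into pairs of an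
      even and an odd index, whatever the parity of \<open>d\<close>.\<close>
    have "degree P \<le> Suc (2 * (d div 2))" using deg by presburger
    then have "poly P x = poly (\<Sum>i\<le>Suc (2 * (d div 2)). monom (coeff P i) i) x"
      by (simp only: poly_as_sum_of_monoms')
    also have "\<dots> = (\<Sum>i\<le>Suc (2 * (d div 2)). coeff P i * x ^ i)"
      by (simp only: poly_sum poly_monom)
    also have "\<dots> = (\<Sum>k\<le>d div 2. coeff P (2 * k) * x ^ (2 * k))"
      unfolding split odd by simp
    also have "\<dots> = poly R (x\<^sup>2)"
      by (simp add: R_def poly_sum poly_monom power_mult)
    finally show ?thesis .
  qed
  ultimately show ?thesis using that by blast
qed

text \<open>With y = x^2, the even polynomials of degree at most \<open>d\<close> are exactly the
  polynomials in y of degree at most \<open>d div 2\<close>; the quotient also covers odd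
  \<open>d\<close>.\<close>

lemma d_std_eq:
  assumes "\<alpha> > 0"
  shows "d_std \<alpha> \<tau> \<epsilon> = (LEAST d. approximable (\<alpha> / 2) \<tau> \<epsilon> (d div 2))"
proof -
  have sq: "\<bar>x\<bar> powr \<alpha> = (x\<^sup>2) powr (\<alpha> / 2)" for x :: real
  proof (cases "x = 0")
    case False
    then have "x\<^sup>2 = \<bar>x\<bar> powr 2" by simp
    then show ?thesis by (simp only: powr_powr) simp
  qed simp
  have "(\<exists>P :: real poly. degree P \<le> d \<and> (\<forall>x. poly P (- x) = poly P x) \<and>
     (\<forall>x\<in>{-1..1}. \<bar>poly P x - exp (- \<tau> * \<bar>x\<bar> powr \<alpha>)\<bar> \<le> \<epsilon>)) \<longleftrightarrow> approximable (\<alpha> / 2) \<tau> \<epsilon> (d div 2)" for d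
  proof
    assume "\<exists>P :: real poly. degree P \<le> d \<and> (\<forall>x. poly P (- x) = poly P x) \<and>
     (\<forall>x\<in>{-1..1}. \<bar>poly P x - exp (- \<tau> * \<bar>x\<bar> powr \<alpha>)\<bar> \<le> \<epsilon>)"
    then obtain P :: "real poly" where P: "degree P \<le> d" "\<And>x. poly P (- x) = poly P x"
      "\<And>x. x \<in> {-1..1} \<Longrightarrow> \<bar>poly P x - exp (- \<tau> * \<bar>x\<bar> powr \<alpha>)\<bar> \<le> \<epsilon>" by blast
    obtain R where R: "degree R \<le> d div 2" "\<And>x. poly P x = poly R (x\<^sup>2)"
      using even_poly_obtain_square[OF P(2) P(1)] by blast
    have "\<bar>poly R y - exp (- \<tau> * y powr (\<alpha> / 2))\<bar> \<le> \<epsilon>" if "y \<in> {0..1}" for y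
    proof -
      have "0 \<le> sqrt y" "sqrt y \<le> 1" using that by auto
      then have "sqrt y \<in> {-1..1}" unfolding atLeastAtMost_iff by linarith
      from P(3)[OF this] show ?thesis using that unfolding R(2) sq by simp
    qed
    then show "approximable (\<alpha> / 2) \<tau> \<epsilon> (d div 2)" using R(1) unfolding approximable_def by blast
  next
    assume "approximable (\<alpha> / 2) \<tau> \<epsilon> (d div 2)"
    then obtain R :: "real poly" where R: "degree R \<le> d div 2"
      "\<And>y. y \<in> {0..1} \<Longrightarrow> \<bar>poly R y - exp (- \<tau> * y powr (\<alpha> / 2))\<bar> \<le> \<epsilon>"
      unfolding approximable_def by blast
    define P where "P = pcompose R (monom 1 2)"
    have P: "poly P x = poly R (x\<^sup>2)" for x by (simp add: P_def poly_pcompose poly_monom)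
    have "degree P \<le> degree R * 2"
      unfolding P_def using degree_pcompose_le[of R "monom 1 2"] by (simp add: degree_monom_eq)
    then have "degree P \<le> d" using R(1) by linarith
    moreover have "\<bar>poly P x - exp (- \<tau> * \<bar>x\<bar> powr \<alpha>)\<bar> \<le> \<epsilon>" if "x \<in> {-1..1}" for x
      using R(2)[of "x\<^sup>2"] that unfolding P sq by (auto simp: abs_square_le_1 abs_le_iff)
    ultimately show "\<exists>P :: real poly. degree P \<le> d \<and> (\<forall>x. poly P (- x) = poly P x) \<and>
     (\<forall>x\<in>{-1..1}. \<bar>poly P x - exp (- \<tau> * \<bar>x\<bar> powr \<alpha>)\<bar> \<le> \<epsilon>)"
      by (intro exI[of _ P]) (auto simp: P)
  qed
  then show ?thesis unfolding d_std_def by simp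
qed

lemma d_sh_eq: "d_sh \<alpha> \<tau> \<epsilon> = (LEAST d. approximable \<alpha> \<tau> \<epsilon> d)"
proof -
  have "(\<exists>Q :: real poly. degree Q \<le> d \<and>
     (\<forall>s\<in>{-1..1}. \<bar>poly Q s - exp (- \<tau> * ((1 + s) / 2) powr \<alpha>)\<bar> \<le> \<epsilon>)) \<longleftrightarrow> approximable \<alpha> \<tau> \<epsilon> d" for d
  proof
    assume "\<exists>Q :: real poly. degree Q \<le> d \<and>
     (\<forall>s\<in>{-1..1}. \<bar>poly Q s - exp (- \<tau> * ((1 + s) / 2) powr \<alpha>)\<bar> \<le> \<epsilon>)"
    then obtain Q :: "real poly" where Q: "degree Q \<le> d"
      "\<And>s. s \<in> {-1..1} \<Longrightarrow> \<bar>poly Q s - exp (- \<tau> * ((1 + s) / 2) powr \<alpha>)\<bar> \<le> \<epsilon>" by blast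
    have "degree (pcompose Q [:-1, 2:]) \<le> d"
      using degree_pcompose_le[of Q "[:-1, 2:]"] Q(1) by simp
    moreover have "\<bar>poly (pcompose Q [:-1, 2:]) y - exp (- \<tau> * y powr \<alpha>)\<bar> \<le> \<epsilon>" if "y \<in> {0..1}" for y
      using Q(2)[of "2 * y - 1"] that by (simp add: poly_pcompose mult.commute)
    ultimately show "approximable \<alpha> \<tau> \<epsilon> d" unfolding approximable_def by blast
  next
    assume "approximable \<alpha> \<tau> \<epsilon> d"
    then obtain R :: "real poly" where R: "degree R \<le> d"
      "\<And>y. y \<in> {0..1} \<Longrightarrow> \<bar>poly R y - exp (- \<tau> * y powr \<alpha>)\<bar> \<le> \<epsilon>"
      unfolding approximable_def by blast
    have "degree (pcompose R [:1/2, 1/2:]) \<le> d"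
      using degree_pcompose_le[of R "[:1/2, 1/2:]"] R(1) by simp
    moreover have "\<bar>poly (pcompose R [:1/2, 1/2:]) s - exp (- \<tau> * ((1 + s) / 2) powr \<alpha>)\<bar> \<le> \<epsilon>" if "s \<in> {-1..1}" for s
      using R(2)[of "(1 + s) / 2"] that by (simp add: poly_pcompose add_divide_distrib)
    ultimately show "\<exists>Q :: real poly. degree Q \<le> d \<and>
     (\<forall>s\<in>{-1..1}. \<bar>poly Q s - exp (- \<tau> * ((1 + s) / 2) powr \<alpha>)\<bar> \<le> \<epsilon>)" by blast
  qed
  then show ?thesis unfolding d_sh_def by simp
qed

text \<open>Halving the degree changes only constants: 2 d is a witness for the upper bound, and d
  div 2 \<le> d keeps the lower one.\<close>

lemma bigtheta_LEAST_div_2: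
  fixes A :: "'a \<Rightarrow> nat \<Rightarrow> bool" and g :: "'a \<Rightarrow> real"
  assumes upper: "\<forall>\<^sub>F x in F. \<exists>d. A x d \<and> real d \<le> C * g x"
    and lower: "\<forall>\<^sub>F x in F. \<forall>d. A x d \<longrightarrow> c * g x \<le> real d + 1"
    and c: "c > 0" and g: "filterlim g at_top F"
  shows "(\<lambda>x. real (LEAST d. A x (d div 2))) \<in> \<Theta>[F](g)"
proof (rule bigtheta_LEAST[OF _ _ c g])
  show "\<forall>\<^sub>F x in F. \<exists>d. A x (d div 2) \<and> real d \<le> (2 * C) * g x"
    using upper
  proof eventually_elim
    case (elim x)
    then obtain d where "A x d" "real d \<le> C * g x" by blast
    then show ?case by (intro exI[of _ "2 * d"]) auto
  qed
  show "\<forall>\<^sub>F x in F. \<forall>d. A x (d div 2) \<longrightarrow> c * g x \<le> real d + 1"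
    using lower
  proof eventually_elim
    case (elim x)
    show ?case
    proof (intro allI impI)
      fix d assume "A x (d div 2)"
      then have "c * g x \<le> real (d div 2) + 1" using elim by blast
      also have "\<dots> \<le> real d + 1" by simp
      finally show "c * g x \<le> real d + 1" .
    qed
  qed
qed

section \<open>Two-sided rates on [0, 1] and their transfer to both signals\<close>

lemma approximable_bigtheta_fixed_error:
  assumes b: "\<beta> > 0" and e: "0 < \<epsilon>" "\<epsilon> < (1 - exp (- 1)) / 4"
  shows "(\<lambda>\<tau>. real (LEAST d. approximable \<beta> \<tau> \<epsilon> d)) \<in> \<Theta>[at_top](\<lambda>\<tau>. \<tau> powr (1 / (2 * \<beta>)))"
    and "(\<lambda>\<tau>. real (LEAST d. approximable \<beta> \<tau> \<epsilon> (d div 2))) \<in> \<Theta>[at_top](\<lambda>\<tau>. \<tau> powr (1 / (2 * \<beta>)))"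
proof -
  define q where "q = 1 / (2 * \<beta>)"
  have q: "q > 0" using b by (simp add: q_def)
  obtain C where C: "\<And>\<tau>. \<tau> \<ge> 1 \<Longrightarrow> \<exists>d. real d \<le> C * \<tau> powr (1 / (2 * \<beta>)) \<and> approximable \<beta> \<tau> \<epsilon> d"
    by (rule approximable_fixed_error[OF b e(1)]) blast
  have upper: "\<forall>\<^sub>F \<tau> in at_top. \<exists>d. approximable \<beta> \<tau> \<epsilon> d \<and> real d \<le> C * \<tau> powr (1 / (2 * \<beta>))"
    using eventually_ge_at_top[of 1] by eventually_elim (use C in blast)
  have lim: "filterlim (\<lambda>\<tau>::real. \<tau> powr (1 / (2 * \<beta>))) at_top at_top"
    unfolding q_def[symmetric] using q by real_asymp
  then have "\<forall>\<^sub>F \<tau> in at_top. \<tau> powr (1 / (2 * \<beta>)) \<ge> 2"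
    by (simp add: filterlim_at_top)
  then have lower: "\<forall>\<^sub>F \<tau> in at_top. \<forall>d. approximable \<beta> \<tau> \<epsilon> d \<longrightarrow>
      (1 - exp (- 1)) / 32 * \<tau> powr (1 / (2 * \<beta>)) \<le> real d + 1"
    using eventually_gt_at_top[of 0]
    by eventually_elim (use approximable_fixed_error_lower[OF b e] in blast)
  have c: "(1 - exp (- 1)) / 32 > (0 :: real)" by simp
  show "(\<lambda>\<tau>. real (LEAST d. approximable \<beta> \<tau> \<epsilon> d)) \<in> \<Theta>[at_top](\<lambda>\<tau>. \<tau> powr (1 / (2 * \<beta>)))"
    by (rule bigtheta_LEAST[OF upper lower c lim])
  show "(\<lambda>\<tau>. real (LEAST d. approximable \<beta> \<tau> \<epsilon> (d div 2))) \<in> \<Theta>[at_top](\<lambda>\<tau>. \<tau> powr (1 / (2 * \<beta>)))"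
    by (rule bigtheta_LEAST_div_2[OF upper lower c lim])
qed

lemma approximable_bigtheta_nonint:
  assumes b: "\<beta> > 0" and nat: "\<forall>j. \<beta> \<noteq> real j" and \<tau>: "\<tau> > 0"
  shows "(\<lambda>\<epsilon>. real (LEAST d. approximable \<beta> \<tau> \<epsilon> d)) \<in> \<Theta>[at_right 0](\<lambda>\<epsilon>. \<epsilon> powr (- 1 / (2 * \<beta>)))"
    and "(\<lambda>\<epsilon>. real (LEAST d. approximable \<beta> \<tau> \<epsilon> (d div 2))) \<in> \<Theta>[at_right 0](\<lambda>\<epsilon>. \<epsilon> powr (- 1 / (2 * \<beta>)))"
proof -
  define q where "q = 1 / (2 * \<beta>)"
  have q: "q > 0" using b by (simp add: q_def)
  have "filterlim (\<lambda>\<epsilon>::real. \<epsilon> powr (- q)) at_top (at_right 0)"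
    using q by real_asymp
  then have lim: "filterlim (\<lambda>\<epsilon>::real. \<epsilon> powr (- 1 / (2 * \<beta>))) at_top (at_right 0)"
    by (simp add: q_def)
  obtain C where upper: "\<forall>\<^sub>F \<epsilon> in at_right 0. \<exists>d. approximable \<beta> \<tau> \<epsilon> d \<and> real d \<le> C * \<epsilon> powr (- 1 / (2 * \<beta>))"
    by (rule approximable_nonint_upper[OF b \<tau>]) blast
  obtain c where c: "c > 0"
    and lower: "\<forall>\<^sub>F \<epsilon> in at_right 0. \<forall>d. approximable \<beta> \<tau> \<epsilon> d \<longrightarrow> c * \<epsilon> powr (- 1 / (2 * \<beta>)) \<le> real d + 1"
    by (rule approximable_nonint_lower[OF b nat \<tau>]) blast
  show "(\<lambda>\<epsilon>. real (LEAST d. approximable \<beta> \<tau> \<epsilon> d)) \<in> \<Theta>[at_right 0](\<lambda>\<epsilon>. \<epsilon> powr (- 1 / (2 * \<beta>)))"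
    by (rule bigtheta_LEAST[OF upper lower c lim])
  show "(\<lambda>\<epsilon>. real (LEAST d. approximable \<beta> \<tau> \<epsilon> (d div 2))) \<in> \<Theta>[at_right 0](\<lambda>\<epsilon>. \<epsilon> powr (- 1 / (2 * \<beta>)))"
    by (rule bigtheta_LEAST_div_2[OF upper lower c lim])
qed

lemma approximable_bigtheta_int:
  fixes m :: nat
  assumes m: "m > 0" and \<tau>: "\<tau> > 0"
  shows "(\<lambda>\<epsilon>. real (LEAST d. approximable (real m) \<tau> \<epsilon> d))
      \<in> \<Theta>[at_right 0](\<lambda>\<epsilon>. ln (1 / \<epsilon>) / ln (ln (1 / \<epsilon>)))"
    and "(\<lambda>\<epsilon>. real (LEAST d. approximable (real m) \<tau> \<epsilon> (d div 2)))
      \<in> \<Theta>[at_right 0](\<lambda>\<epsilon>. ln (1 / \<epsilon>) / ln (ln (1 / \<epsilon>)))"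
proof -
  have lim: "filterlim (\<lambda>\<epsilon>::real. ln (1 / \<epsilon>) / ln (ln (1 / \<epsilon>))) at_top (at_right 0)"
    by real_asymp
  have c: "1 / (4 * real m) > 0" using m by simp
  note bounds = approximable_int_upper[OF m \<tau>] approximable_int_lower[OF m \<tau>] c lim
  show "(\<lambda>\<epsilon>. real (LEAST d. approximable (real m) \<tau> \<epsilon> d))
      \<in> \<Theta>[at_right 0](\<lambda>\<epsilon>. ln (1 / \<epsilon>) / ln (ln (1 / \<epsilon>)))"
    by (rule bigtheta_LEAST[OF bounds])
  show "(\<lambda>\<epsilon>. real (LEAST d. approximable (real m) \<tau> \<epsilon> (d div 2)))
      \<in> \<Theta>[at_right 0](\<lambda>\<epsilon>. ln (1 / \<epsilon>) / ln (ln (1 / \<epsilon>)))"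
    by (rule bigtheta_LEAST_div_2[OF bounds])
qed

theorem mainTheorem4:
  fixes \<alpha> :: real
  assumes "\<alpha> > 0"
  shows
    "(\<forall>\<epsilon>::real. 0 < \<epsilon> \<and> \<epsilon> < (1 - exp (- 1)) / 4 \<longrightarrow>
        (\<lambda>\<tau>::real. real (d_std \<alpha> \<tau> \<epsilon>)) \<in> \<Theta>[at_top](\<lambda>\<tau>. \<tau> powr (1 / \<alpha>)) \<and>
        (\<lambda>\<tau>::real. real (d_sh \<alpha> \<tau> \<epsilon>)) \<in> \<Theta>[at_top](\<lambda>\<tau>. \<tau> powr (1 / (2 * \<alpha>)))) \<and>
     (\<forall>\<tau>::real. 0 < \<tau> \<longrightarrow>
        ((\<exists>m::nat. 0 < m \<and> even m \<and> \<alpha> = real m) \<longrightarrow>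
          (\<lambda>\<epsilon>::real. real (d_std \<alpha> \<tau> \<epsilon>)) \<in> \<Theta>[at_right 0](\<lambda>\<epsilon>. ln (1 / \<epsilon>) / ln (ln (1 / \<epsilon>)))) \<and>
        ((\<exists>m::nat. 0 < m \<and> odd m \<and> \<alpha> = real m) \<or> \<alpha> \<notin> \<int> \<longrightarrow>
          (\<lambda>\<epsilon>::real. real (d_std \<alpha> \<tau> \<epsilon>)) \<in> \<Theta>[at_right 0](\<lambda>\<epsilon>. \<epsilon> powr (- 1 / \<alpha>))) \<and>
        ((\<exists>m::nat. 0 < m \<and> \<alpha> = real m) \<longrightarrow>
          (\<lambda>\<epsilon>::real. real (d_sh \<alpha> \<tau> \<epsilon>)) \<in> \<Theta>[at_right 0](\<lambda>\<epsilon>. ln (1 / \<epsilon>) / ln (ln (1 / \<epsilon>)))) \<and>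
        (\<alpha> \<notin> \<int> \<longrightarrow>
          (\<lambda>\<epsilon>::real. real (d_sh \<alpha> \<tau> \<epsilon>)) \<in> \<Theta>[at_right 0](\<lambda>\<epsilon>. \<epsilon> powr (- 1 / (2 * \<alpha>)))))"
proof (intro conjI allI impI)
  fix \<epsilon> :: real assume e: "0 < \<epsilon> \<and> \<epsilon> < (1 - exp (- 1)) / 4"
  show "(\<lambda>\<tau>::real. real (d_std \<alpha> \<tau> \<epsilon>)) \<in> \<Theta>[at_top](\<lambda>\<tau>. \<tau> powr (1 / \<alpha>))"
    unfolding d_std_eq[OF assms]
    using approximable_bigtheta_fixed_error(2)[of "\<alpha> / 2" \<epsilon>] e assms by simp
  show "(\<lambda>\<tau>::real. real (d_sh \<alpha> \<tau> \<epsilon>)) \<in> \<Theta>[at_top](\<lambda>\<tau>. \<tau> powr (1 / (2 * \<alpha>)))"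
    unfolding d_sh_eq using approximable_bigtheta_fixed_error(1) e assms by blast
next
  fix \<tau> :: real assume \<tau>: "0 < \<tau>"
  {
    assume "\<exists>m::nat. 0 < m \<and> even m \<and> \<alpha> = real m"
    then obtain m k :: nat where "0 < m" "\<alpha> = real m" "m = 2 * k" by (auto elim!: evenE)
    then have k: "k > 0" "\<alpha> / 2 = real k" by auto
    show "(\<lambda>\<epsilon>::real. real (d_std \<alpha> \<tau> \<epsilon>)) \<in> \<Theta>[at_right 0](\<lambda>\<epsilon>. ln (1 / \<epsilon>) / ln (ln (1 / \<epsilon>)))"
      unfolding d_std_eq[OF assms] k(2) by (rule approximable_bigtheta_int(2)[OF k(1) \<tau>])
  next
    assume h: "(\<exists>m::nat. 0 < m \<and> odd m \<and> \<alpha> = real m) \<or> \<alpha> \<notin> \<int>"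
    \<comment> \<open>Odd and noninteger \<alpha> form one case: either way the exponent \<alpha> /
      2 in y is not a natural number.\<close>
    have nat: "\<forall>j. \<alpha> / 2 \<noteq> real j"
    proof (intro allI notI)
      fix j assume "\<alpha> / 2 = real j"
      then have a: "\<alpha> = real (2 * j)" by simp
      from h show False
      proof
        assume "\<exists>m::nat. 0 < m \<and> odd m \<and> \<alpha> = real m"
        then obtain m :: nat where "odd m" "real m = real (2 * j)" using a by auto
        then show False by (simp only: of_nat_eq_iff) simp
      next
        assume "\<alpha> \<notin> \<int>"
        then show False unfolding a by simp
      qed
    qed
    have "\<alpha> / 2 > 0" using assms by simp
    from approximable_bigtheta_nonint(2)[OF this nat \<tau>]
    show "(\<lambda>\<epsilon>::real. real (d_std \<alpha> \<tau> \<epsilon>)) \<in> \<Theta>[at_right 0](\<lambda>\<epsilon>. \<epsilon> powr (- 1 / \<alpha>))"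
      unfolding d_std_eq[OF assms] by simp
  next
    assume "\<exists>m::nat. 0 < m \<and> \<alpha> = real m"
    then obtain m :: nat where m: "0 < m" "\<alpha> = real m" by blast
    show "(\<lambda>\<epsilon>::real. real (d_sh \<alpha> \<tau> \<epsilon>)) \<in> \<Theta>[at_right 0](\<lambda>\<epsilon>. ln (1 / \<epsilon>) / ln (ln (1 / \<epsilon>)))"
      unfolding d_sh_eq m(2) by (rule approximable_bigtheta_int(1)[OF m(1) \<tau>])
  next
    assume "\<alpha> \<notin> \<int>"
    then have nat: "\<forall>j. \<alpha> \<noteq> real j" by auto
    show "(\<lambda>\<epsilon>::real. real (d_sh \<alpha> \<tau> \<epsilon>)) \<in> \<Theta>[at_right 0](\<lambda>\<epsilon>. \<epsilon> powr (- 1 / (2 * \<alpha>)))"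
      unfolding d_sh_eq by (rule approximable_bigtheta_nonint(1)[OF assms nat \<tau>])
  }
qed

end
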